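(* Let $(A,\widehat H)$ be a solution of the temporal-gauge equations (a) and (c) below (with $\varphi=0$, so $E=-\dot A$ and $D=-\epsilon\dot A$). Suppose that the initial values of $D$ and of $\widehat D$ (the latter in $H(\operatorname{div};\Omega)$) satisfy equation (b) below for all $K\in\mathcal{T}_h$, and let $\widehat D$ be the solution, with this initial value, of $$\dot{\widehat D}+J=\operatorname{curl}\widehat H .$$ Then $(A,0,\widehat H,\widehat D)$ is a solution of the domain-decomposed Maxwell problem consisting of the following equations (a)--(d) (with $\varphi=0$), at all times: (a) $\displaystyle\int_K\bigl(A'\cdot(\dot D+J)-\operatorname{curl}A'\cdot H\bigr)+\int_{\partial K}(A'\times\widehat H)\cdot\mathbf{n}=0$ for all $A'\in H(\operatorname{curl};K)$ and all $K\in\mathcal{T}_h$; (b) $\displaystyle\int_K(\operatorname{grad}\varphi'\cdot D+\varphi'\rho)-\int_{\partial K}\varphi'\,\widehat D\cdot\mathbf{n}=0$ for all $\varphi'\in H^1(K)$ and all $K\in\mathcal{T}_h$; (c) $\displaystyle\sum_{K\in\mathcal{T}_h}\int_{\partial K}(A\times\widehat H')\cdot\mathbf{n}=0$ for all $\widehat H'\in H(\operatorname{curl};\Omega)$; (d) $\displaystyle\sum_{K\in\mathcal{T}_h}\int_{\partial K}\varphi\,\widehat D'\cdot\mathbf{n}=0$ for all $\widehat D'\in H(\operatorname{div};\Omega)$.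
   Context: Setting. $\Omega\subset\mathbb{R}^3$ is a bounded polyhedral Lipschitz domain with a triangulation $\mathcal{T}_h$ by tetrahedra $K$; $\mathbf{n}$ denotes outer unit normals. $H^1$, $H(\operatorname{curl})$, $H(\operatorname{div})$ are the usual spaces of $L^2$ functions/fields with $L^2$ gradient, curl, divergence. $H^1(\mathcal{T}_h)$ and $H(\operatorname{curl};\mathcal{T}_h)$ are the spaces of $L^2$ functions/fields whose restriction to each $K\in\mathcal{T}_h$ is in $H^1(K)$, respectively $H(\operatorname{curl};K)$. Time $t$ ranges over an interval $I$ containing an initial time, and a dot denotes $\partial_t$. The tensors $\epsilon=\epsilon_{ij}(x,t)$ and $\mu=\mu_{ij}(x,t)$ are $L^\infty$, symmetric and uniformly elliptic. The current density $J$ is a given $C^0$ curve in $H(\operatorname{div};\Omega)$ and the charge density $\rho$ is a given $C^1$ curve in $L^2(\Omega)$, with $\dot\rho+\operatorname{div}J=0$. Given $(A,\varphi)$ one defines, elementwise on each $K$, $E=-(\dot A+\operatorname{grad}\varphi)$, $B=\operatorname{curl}A$, $D=\epsilon E$, $H=\mu^{-1}B$. Regularity required of a solution $(A,\varphi,\widehat H,\widehat D)$: $A$ is a $C^1$ curve in $H(\operatorname{curl};\mathcal{T}_h)$, $\varphi$ is a $C^0$ curve in $H^1(\mathcal{T}_h)$, $D$ is a $C^1$ curve in $L^2(\Omega,\mathbb{R}^3)$, $\widehat H$ is a $C^0$ curve in $H(\operatorname{curl};\Omega)$, and $\widehat D$ is a $C^0$ curve in $H(\operatorname{div};\Omega)$.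 A solution $(A,\widehat H)$ of (a) and (c) has the corresponding regularity with $\varphi=0$. Boundary integrals are in the trace (duality) sense: $\int_{\partial K}(u\times v)\cdot\mathbf{n}=\int_K(\operatorname{curl}u\cdot v-u\cdot\operatorname{curl}v)$ for $u,v\in H(\operatorname{curl};K)$, and $\int_{\partial K}\psi\,w\cdot\mathbf{n}=\int_K(\operatorname{grad}\psi\cdot w+\psi\operatorname{div}w)$ for $\psi\in H^1(K)$, $w\in H(\operatorname{div};K)$. *)

theory Defs
  imports "HOL-Analysis.Analysis"
begin

type_synonym R3 = "real ^ 3"

section \<open>Square integrable functions\<close>

text \<open>Elements of the function spaces are represented by functions on all of space whose
  values outside the set under consideration (and on null sets) are irrelevant.\<close>

definition L2 :: "R3 set \<Rightarrow> (R3 \<Rightarrow> 'b::euclidean_space) set" where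
  "L2 S = {f. f \<in> borel_measurable (lebesgue_on S) \<and>
              integrable (lebesgue_on S) (\<lambda>x. (norm (f x))\<^sup>2)}"

definition L2_norm :: "R3 set \<Rightarrow> (R3 \<Rightarrow> 'b::euclidean_space) \<Rightarrow> real" where
  "L2_norm S f = sqrt (\<integral>x. (norm (f x))\<^sup>2 \<partial>lebesgue_on S)"

section \<open>Test functions and weak derivatives\<close>

definition grad :: "(R3 \<Rightarrow> real) \<Rightarrow> R3 \<Rightarrow> R3" where
  "grad f x = (\<chi> i. frechet_derivative f (at x) (axis i 1))"

primrec C_k :: "nat \<Rightarrow> (R3 \<Rightarrow> real) \<Rightarrow> bool" where
  "C_k 0 f \<longleftrightarrow> continuous_on UNIV f"
| "C_k (Suc k) f \<longleftrightarrow> (\<forall>x. f differentiable (at x)) \<and> (\<forall>i. C_k k (\<lambda>x. grad f x $ i))"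

definition test_functions :: "R3 set \<Rightarrow> (R3 \<Rightarrow> real) set" where
  "test_functions S =
     {\<psi>. (\<forall>k. C_k k \<psi>) \<and> compact (closure {x. \<psi> x \<noteq> 0}) \<and> closure {x. \<psi> x \<noteq> 0} \<subseteq> S}"

text \<open>The distributional gradient, curl and divergence on an open set \<open>S\<close>, required to be
  square integrable. The curl is the componentwise distributional one: with
  \<open>\<langle>\<partial>\<^sub>j u\<^sub>k, \<psi>\<rangle> = - \<integral> u\<^sub>k \<partial>\<^sub>j \<psi>\<close> one gets \<open>\<langle>curl u, \<psi>\<rangle> = \<integral> u \<times> grad \<psi>\<close>.\<close>

definition has_weak_grad :: "R3 set \<Rightarrow> (R3 \<Rightarrow> real) \<Rightarrow> (R3 \<Rightarrow> R3) \<Rightarrow> bool" where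
  "has_weak_grad S f g \<longleftrightarrow> g \<in> L2 S \<and>
     (\<forall>\<psi>\<in>test_functions S.
        (\<integral>x. \<psi> x *\<^sub>R g x \<partial>lebesgue_on S) = - (\<integral>x. f x *\<^sub>R grad \<psi> x \<partial>lebesgue_on S))"

definition has_weak_curl :: "R3 set \<Rightarrow> (R3 \<Rightarrow> R3) \<Rightarrow> (R3 \<Rightarrow> R3) \<Rightarrow> bool" where
  "has_weak_curl S u c \<longleftrightarrow> c \<in> L2 S \<and>
     (\<forall>\<psi>\<in>test_functions S.
        (\<integral>x. \<psi> x *\<^sub>R c x \<partial>lebesgue_on S) = (\<integral>x. cross3 (u x) (grad \<psi> x) \<partial>lebesgue_on S))"

definition has_weak_div :: "R3 set \<Rightarrow> (R3 \<Rightarrow> R3) \<Rightarrow> (R3 \<Rightarrow> real) \<Rightarrow> bool" where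
  "has_weak_div S u d \<longleftrightarrow> d \<in> L2 S \<and>
     (\<forall>\<psi>\<in>test_functions S.
        (\<integral>x. \<psi> x * d x \<partial>lebesgue_on S) = - (\<integral>x. u x \<bullet> grad \<psi> x \<partial>lebesgue_on S))"

text \<open>Weak derivatives are unique up to null sets; these are arbitrary representatives.\<close>

definition weak_grad :: "R3 set \<Rightarrow> (R3 \<Rightarrow> real) \<Rightarrow> R3 \<Rightarrow> R3" where
  "weak_grad S f = (SOME g. has_weak_grad S f g)"

definition weak_curl :: "R3 set \<Rightarrow> (R3 \<Rightarrow> R3) \<Rightarrow> R3 \<Rightarrow> R3" where
  "weak_curl S u = (SOME c. has_weak_curl S u c)"

definition weak_div :: "R3 set \<Rightarrow> (R3 \<Rightarrow> R3) \<Rightarrow> R3 \<Rightarrow> real" where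
  "weak_div S u = (SOME d. has_weak_div S u d)"

definition H1 :: "R3 set \<Rightarrow> (R3 \<Rightarrow> real) set" where
  "H1 S = {f \<in> L2 S. \<exists>g. has_weak_grad S f g}"

definition Hcurl :: "R3 set \<Rightarrow> (R3 \<Rightarrow> R3) set" where
  "Hcurl S = {u \<in> L2 S. \<exists>c. has_weak_curl S u c}"

definition Hdiv :: "R3 set \<Rightarrow> (R3 \<Rightarrow> R3) set" where
  "Hdiv S = {u \<in> L2 S. \<exists>d. has_weak_div S u d}"

definition Hcurl_norm :: "R3 set \<Rightarrow> (R3 \<Rightarrow> R3) \<Rightarrow> real" where
  "Hcurl_norm S u = sqrt ((L2_norm S u)\<^sup>2 + (L2_norm S (weak_curl S u))\<^sup>2)"

definition Hdiv_norm :: "R3 set \<Rightarrow> (R3 \<Rightarrow> R3) \<Rightarrow> real" where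
  "Hdiv_norm S u = sqrt ((L2_norm S u)\<^sup>2 + (L2_norm S (weak_div S u))\<^sup>2)"

section \<open>Domain, mesh and elementwise spaces\<close>

text \<open>Near each boundary point, a Lipschitz domain is the part of space lying strictly above
  the graph of a Lipschitz function, in the direction of some unit vector \<open>e\<close>; the graph
  function is defined on the plane orthogonal to \<open>e\<close>.\<close>

definition lipschitz_domain :: "R3 set \<Rightarrow> bool" where
  "lipschitz_domain \<Omega> \<longleftrightarrow> open \<Omega> \<and> connected \<Omega> \<and> \<Omega> \<noteq> {} \<and>
     (\<forall>p\<in>frontier \<Omega>. \<exists>U e L \<gamma>. open U \<and> p \<in> U \<and> norm e = 1 \<and>
        L-lipschitz_on {y. y \<bullet> e = 0} \<gamma> \<and>
        \<Omega> \<inter> U = {x \<in> U. \<gamma> (x - (x \<bullet> e) *\<^sub>R e) < x \<bullet> e})"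

definition bounded_polyhedral_lipschitz_domain :: "R3 set \<Rightarrow> bool" where
  "bounded_polyhedral_lipschitz_domain \<Omega> \<longleftrightarrow> lipschitz_domain \<Omega> \<and> bounded \<Omega> \<and>
     (\<exists>\<P>. finite \<P> \<and> (\<forall>P\<in>\<P>. polytope P) \<and> closure \<Omega> = \<Union>\<P>)"

text \<open>The mesh consists of closed tetrahedra, meeting in common faces. Function spaces over a
  tetrahedron \<open>K\<close> are those over the open set \<open>interior K\<close>.\<close>

definition tetrahedral_mesh :: "R3 set \<Rightarrow> R3 set set \<Rightarrow> bool" where
  "tetrahedral_mesh \<Omega> \<T> \<longleftrightarrow>
     triangulation \<T> \<and> (\<forall>K\<in>\<T>. 3 simplex K) \<and> \<Union>\<T> = closure \<Omega>"

definition H1_mesh :: "R3 set \<Rightarrow> R3 set set \<Rightarrow> (R3 \<Rightarrow> real) set" where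
  "H1_mesh \<Omega> \<T> = {f \<in> L2 \<Omega>. \<forall>K\<in>\<T>. f \<in> H1 (interior K)}"

definition Hcurl_mesh :: "R3 set \<Rightarrow> R3 set set \<Rightarrow> (R3 \<Rightarrow> R3) set" where
  "Hcurl_mesh \<Omega> \<T> = {u \<in> L2 \<Omega>. \<forall>K\<in>\<T>. u \<in> Hcurl (interior K)}"

text \<open>The interiors of distinct tetrahedra of a mesh are disjoint, so at most one summand
  is nonzero at each point.\<close>

definition mesh_grad :: "R3 set set \<Rightarrow> (R3 \<Rightarrow> real) \<Rightarrow> R3 \<Rightarrow> R3" where
  "mesh_grad \<T> f x = (\<Sum>K\<in>\<T>. indicator (interior K) x *\<^sub>R weak_grad (interior K) f x)"

definition mesh_curl :: "R3 set set \<Rightarrow> (R3 \<Rightarrow> R3) \<Rightarrow> R3 \<Rightarrow> R3" where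
  "mesh_curl \<T> u x = (\<Sum>K\<in>\<T>. indicator (interior K) x *\<^sub>R weak_curl (interior K) u x)"

definition H1_mesh_norm :: "R3 set \<Rightarrow> R3 set set \<Rightarrow> (R3 \<Rightarrow> real) \<Rightarrow> real" where
  "H1_mesh_norm \<Omega> \<T> f = sqrt ((L2_norm \<Omega> f)\<^sup>2 + (L2_norm \<Omega> (mesh_grad \<T> f))\<^sup>2)"

definition Hcurl_mesh_norm :: "R3 set \<Rightarrow> R3 set set \<Rightarrow> (R3 \<Rightarrow> R3) \<Rightarrow> real" where
  "Hcurl_mesh_norm \<Omega> \<T> u = sqrt ((L2_norm \<Omega> u)\<^sup>2 + (L2_norm \<Omega> (mesh_curl \<T> u))\<^sup>2)"

text \<open>Boundary integrals in the trace sense: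
  \<open>bdry_curl K u v\<close> is \<open>\<integral>\<^bsub>\<partial>K\<^esub> (u \<times> v) \<bullet> n\<close> and \<open>bdry_div K \<psi> w\<close> is \<open>\<integral>\<^bsub>\<partial>K\<^esub> \<psi> w \<bullet> n\<close>.\<close>

definition bdry_curl :: "R3 set \<Rightarrow> (R3 \<Rightarrow> R3) \<Rightarrow> (R3 \<Rightarrow> R3) \<Rightarrow> real" where
  "bdry_curl K u v =
     (\<integral>x. weak_curl (interior K) u x \<bullet> v x - u x \<bullet> weak_curl (interior K) v x
        \<partial>lebesgue_on (interior K))"

definition bdry_div :: "R3 set \<Rightarrow> (R3 \<Rightarrow> real) \<Rightarrow> (R3 \<Rightarrow> R3) \<Rightarrow> real" where
  "bdry_div K \<psi> w =
     (\<integral>x. weak_grad (interior K) \<psi> x \<bullet> w x + \<psi> x * weak_div (interior K) w x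
        \<partial>lebesgue_on (interior K))"

section \<open>Curves in function spaces\<close>

text \<open>Here \<open>X\<close> is a function space with norm \<open>N\<close>; limits are one-sided at endpoints of the
  interval \<open>I\<close>.\<close>

definition has_curve_deriv ::
    "((R3 \<Rightarrow> 'b) \<Rightarrow> real) \<Rightarrow> real set \<Rightarrow> (real \<Rightarrow> R3 \<Rightarrow> 'b::euclidean_space) \<Rightarrow> (R3 \<Rightarrow> 'b) \<Rightarrow> real \<Rightarrow> bool"
  where
  "has_curve_deriv N I u v t \<longleftrightarrow>
     ((\<lambda>s. N (\<lambda>x. (u s x - u t x) /\<^sub>R (s - t) - v x)) \<longlongrightarrow> 0) (at t within I)"

definition C0_curve ::
    "(R3 \<Rightarrow> 'b) set \<Rightarrow> ((R3 \<Rightarrow> 'b) \<Rightarrow> real) \<Rightarrow> real set \<Rightarrow> (real \<Rightarrow> R3 \<Rightarrow> 'b::euclidean_space) \<Rightarrow> bool"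
  where
  "C0_curve X N I u \<longleftrightarrow> (\<forall>t\<in>I. u t \<in> X) \<and>
     (\<forall>t\<in>I. ((\<lambda>s. N (\<lambda>x. u s x - u t x)) \<longlongrightarrow> 0) (at t within I))"

definition C1_curve ::
    "(R3 \<Rightarrow> 'b) set \<Rightarrow> ((R3 \<Rightarrow> 'b) \<Rightarrow> real) \<Rightarrow> real set \<Rightarrow> (real \<Rightarrow> R3 \<Rightarrow> 'b::euclidean_space) \<Rightarrow> bool"
  where
  "C1_curve X N I u \<longleftrightarrow> (\<forall>t\<in>I. u t \<in> X) \<and>
     (\<exists>v. C0_curve X N I v \<and> (\<forall>t\<in>I. has_curve_deriv N I u (v t) t))"

text \<open>The time derivative in \<open>L2 \<Omega>\<close>, unique up to null sets. A derivative with respect to one of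
  the stronger norms above is also one in \<open>L2 \<Omega>\<close>.\<close>

definition dt :: "R3 set \<Rightarrow> real set \<Rightarrow> (real \<Rightarrow> R3 \<Rightarrow> 'b::euclidean_space) \<Rightarrow> real \<Rightarrow> R3 \<Rightarrow> 'b" where
  "dt \<Omega> I u t = (SOME v. v \<in> L2 \<Omega> \<and> has_curve_deriv (L2_norm \<Omega>) I u v t)"

section \<open>Data of the Maxwell problem\<close>

text \<open>The tensor is bounded in \<open>(t, x)\<close>, and since it multiplies fields given for each \<open>t\<close>,
  the properties are required for every \<open>t\<close> and almost every \<open>x\<close>, with constants independent
  of \<open>t\<close>.\<close>

definition material_tensor :: "R3 set \<Rightarrow> real set \<Rightarrow> (real \<Rightarrow> R3 \<Rightarrow> real ^ 3 ^ 3) \<Rightarrow> bool" where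
  "material_tensor \<Omega> I \<epsilon> \<longleftrightarrow>
     (\<lambda>(t, x). \<epsilon> t x) \<in> borel_measurable (lebesgue_on (I \<times> \<Omega>)) \<and>
     (\<forall>t\<in>I. \<epsilon> t \<in> borel_measurable (lebesgue_on \<Omega>)) \<and>
     (\<exists>M. \<forall>t\<in>I. AE x in lebesgue_on \<Omega>. norm (\<epsilon> t x) \<le> M) \<and>
     (\<forall>t\<in>I. AE x in lebesgue_on \<Omega>. transpose (\<epsilon> t x) = \<epsilon> t x) \<and>
     (\<exists>c>0. \<forall>t\<in>I. AE x in lebesgue_on \<Omega>. \<forall>\<xi>. c * (norm \<xi>)\<^sup>2 \<le> \<xi> \<bullet> (\<epsilon> t x *v \<xi>))"

definition sources ::
    "R3 set \<Rightarrow> real set \<Rightarrow> (real \<Rightarrow> R3 \<Rightarrow> R3) \<Rightarrow> (real \<Rightarrow> R3 \<Rightarrow> real) \<Rightarrow> bool" where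
  "sources \<Omega> I J \<rho> \<longleftrightarrow>
     C0_curve (Hdiv \<Omega>) (Hdiv_norm \<Omega>) I J \<and>
     C1_curve (L2 \<Omega>) (L2_norm \<Omega>) I \<rho> \<and>
     (\<forall>t\<in>I. AE x in lebesgue_on \<Omega>. dt \<Omega> I \<rho> t x + weak_div \<Omega> (J t) x = 0)"

definition E_field ::
    "R3 set \<Rightarrow> R3 set set \<Rightarrow> real set \<Rightarrow> (real \<Rightarrow> R3 \<Rightarrow> R3) \<Rightarrow> (real \<Rightarrow> R3 \<Rightarrow> real)
      \<Rightarrow> real \<Rightarrow> R3 \<Rightarrow> R3" where
  "E_field \<Omega> \<T> I A \<phi> t x = - (dt \<Omega> I A t x + mesh_grad \<T> (\<phi> t) x)"

definition D_field ::
    "R3 set \<Rightarrow> R3 set set \<Rightarrow> real set \<Rightarrow> (real \<Rightarrow> R3 \<Rightarrow> real ^ 3 ^ 3) \<Rightarrow>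
      (real \<Rightarrow> R3 \<Rightarrow> R3) \<Rightarrow> (real \<Rightarrow> R3 \<Rightarrow> real) \<Rightarrow> real \<Rightarrow> R3 \<Rightarrow> R3" where
  "D_field \<Omega> \<T> I \<epsilon> A \<phi> t x = \<epsilon> t x *v E_field \<Omega> \<T> I A \<phi> t x"

definition H_field ::
    "R3 set set \<Rightarrow> (real \<Rightarrow> R3 \<Rightarrow> real ^ 3 ^ 3) \<Rightarrow> (real \<Rightarrow> R3 \<Rightarrow> R3) \<Rightarrow> real \<Rightarrow> R3 \<Rightarrow> R3" where
  "H_field \<T> \<mu> A t x = matrix_inv (\<mu> t x) *v mesh_curl \<T> (A t) x"

section \<open>The equations at a fixed time, and solutions\<close>

text \<open>In \<open>eq_a\<close>, the argument \<open>D'\<close> is the time derivative of \<open>D\<close>.\<close>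

definition eq_a ::
    "R3 set set \<Rightarrow> (R3 \<Rightarrow> R3) \<Rightarrow> (R3 \<Rightarrow> R3) \<Rightarrow> (R3 \<Rightarrow> R3) \<Rightarrow> (R3 \<Rightarrow> R3) \<Rightarrow> bool" where
  "eq_a \<T> D' J H Hh \<longleftrightarrow>
     (\<forall>K\<in>\<T>. \<forall>A'\<in>Hcurl (interior K).
        (\<integral>x. A' x \<bullet> (D' x + J x) - weak_curl (interior K) A' x \<bullet> H x \<partial>lebesgue_on (interior K))
        + bdry_curl K A' Hh = 0)"

definition eq_b ::
    "R3 set set \<Rightarrow> (R3 \<Rightarrow> R3) \<Rightarrow> (R3 \<Rightarrow> real) \<Rightarrow> (R3 \<Rightarrow> R3) \<Rightarrow> bool" where
  "eq_b \<T> D \<rho> Dh \<longleftrightarrow>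
     (\<forall>K\<in>\<T>. \<forall>\<phi>'\<in>H1 (interior K).
        (\<integral>x. weak_grad (interior K) \<phi>' x \<bullet> D x + \<phi>' x * \<rho> x \<partial>lebesgue_on (interior K))
        - bdry_div K \<phi>' Dh = 0)"

definition eq_c :: "R3 set \<Rightarrow> R3 set set \<Rightarrow> (R3 \<Rightarrow> R3) \<Rightarrow> bool" where
  "eq_c \<Omega> \<T> A \<longleftrightarrow> (\<forall>Hh'\<in>Hcurl \<Omega>. (\<Sum>K\<in>\<T>. bdry_curl K A Hh') = 0)"

definition eq_d :: "R3 set \<Rightarrow> R3 set set \<Rightarrow> (R3 \<Rightarrow> real) \<Rightarrow> bool" where
  "eq_d \<Omega> \<T> \<phi> \<longleftrightarrow> (\<forall>Dh'\<in>Hdiv \<Omega>. (\<Sum>K\<in>\<T>. bdry_div K \<phi> Dh') = 0)"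

definition maxwell_solution ::
    "R3 set \<Rightarrow> R3 set set \<Rightarrow> real set \<Rightarrow> (real \<Rightarrow> R3 \<Rightarrow> real ^ 3 ^ 3) \<Rightarrow> (real \<Rightarrow> R3 \<Rightarrow> real ^ 3 ^ 3) \<Rightarrow>
      (real \<Rightarrow> R3 \<Rightarrow> R3) \<Rightarrow> (real \<Rightarrow> R3 \<Rightarrow> real) \<Rightarrow>
      (real \<Rightarrow> R3 \<Rightarrow> R3) \<Rightarrow> (real \<Rightarrow> R3 \<Rightarrow> real) \<Rightarrow> (real \<Rightarrow> R3 \<Rightarrow> R3) \<Rightarrow> (real \<Rightarrow> R3 \<Rightarrow> R3) \<Rightarrow> bool"
  where
  "maxwell_solution \<Omega> \<T> I \<epsilon> \<mu> J \<rho> A \<phi> Hh Dh \<longleftrightarrow>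
     C1_curve (Hcurl_mesh \<Omega> \<T>) (Hcurl_mesh_norm \<Omega> \<T>) I A \<and>
     C0_curve (H1_mesh \<Omega> \<T>) (H1_mesh_norm \<Omega> \<T>) I \<phi> \<and>
     C1_curve (L2 \<Omega>) (L2_norm \<Omega>) I (D_field \<Omega> \<T> I \<epsilon> A \<phi>) \<and>
     C0_curve (Hcurl \<Omega>) (Hcurl_norm \<Omega>) I Hh \<and>
     C0_curve (Hdiv \<Omega>) (Hdiv_norm \<Omega>) I Dh \<and>
     (\<forall>t\<in>I.
        eq_a \<T> (dt \<Omega> I (D_field \<Omega> \<T> I \<epsilon> A \<phi>) t) (J t) (H_field \<T> \<mu> A t) (Hh t) \<and>
        eq_b \<T> (D_field \<Omega> \<T> I \<epsilon> A \<phi> t) (\<rho> t) (Dh t) \<and>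
        eq_c \<Omega> \<T> (A t) \<and>
        eq_d \<Omega> \<T> (\<phi> t))"

definition temporal_gauge_solution ::
    "R3 set \<Rightarrow> R3 set set \<Rightarrow> real set \<Rightarrow> (real \<Rightarrow> R3 \<Rightarrow> real ^ 3 ^ 3) \<Rightarrow> (real \<Rightarrow> R3 \<Rightarrow> real ^ 3 ^ 3) \<Rightarrow>
      (real \<Rightarrow> R3 \<Rightarrow> R3) \<Rightarrow> (real \<Rightarrow> R3 \<Rightarrow> R3) \<Rightarrow> (real \<Rightarrow> R3 \<Rightarrow> R3) \<Rightarrow> bool"
  where
  "temporal_gauge_solution \<Omega> \<T> I \<epsilon> \<mu> J A Hh \<longleftrightarrow>
     C1_curve (Hcurl_mesh \<Omega> \<T>) (Hcurl_mesh_norm \<Omega> \<T>) I A \<and>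
     C1_curve (L2 \<Omega>) (L2_norm \<Omega>) I (D_field \<Omega> \<T> I \<epsilon> A (\<lambda>t x. 0)) \<and>
     C0_curve (Hcurl \<Omega>) (Hcurl_norm \<Omega>) I Hh \<and>
     (\<forall>t\<in>I.
        eq_a \<T> (dt \<Omega> I (D_field \<Omega> \<T> I \<epsilon> A (\<lambda>t x. 0)) t) (J t) (H_field \<T> \<mu> A t) (Hh t) \<and>
        eq_c \<Omega> \<T> (A t))"

text \<open>Solutions of the evolution equation for \<open>Dh\<close> are understood as continuously differentiable
  curves in \<open>L2 \<Omega>\<close>, where the right-hand side takes its values; continuity in \<open>Hdiv \<Omega>\<close> is not
  presupposed.\<close>

definition Dh_evolution ::
    "R3 set \<Rightarrow> real set \<Rightarrow> (real \<Rightarrow> R3 \<Rightarrow> R3) \<Rightarrow> (real \<Rightarrow> R3 \<Rightarrow> R3) \<Rightarrow> (real \<Rightarrow> R3 \<Rightarrow> R3) \<Rightarrow> bool"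
  where
  "Dh_evolution \<Omega> I J Hh Dh \<longleftrightarrow>
     C1_curve (L2 \<Omega>) (L2_norm \<Omega>) I Dh \<and>
     (\<forall>t\<in>I. AE x in lebesgue_on \<Omega>. dt \<Omega> I Dh t x + J t x = weak_curl \<Omega> (Hh t) x)"

end

theory Submission
  imports Defs
begin

text \<open>Since \<open>div curl = 0\<close>, the evolution equation and charge conservation show that
  \<open>div Dh - \<rho>\<close> is constant in time, although it need not vanish: equation (b) only fixes the
  normal trace of \<open>Dh\<close> on each \<open>\<partial>K\<close>. Hence \<open>Dh\<close> inherits its continuity in \<open>Hdiv \<Omega>\<close> from
  that of \<open>\<rho>\<close> in \<open>L2 \<Omega>\<close>, and up to a constant the left-hand side of (b) is
  \<open>\<integral>\<^bsub>K\<^esub> grad \<phi>' \<bullet> (D - Dh)\<close>. Its time derivative vanishes by (a) with \<open>A' = grad \<phi>'\<close>, which is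
  curl free. Identifying \<open>weak_div (interior K) Dh\<close> with the restriction of \<open>weak_div \<Omega> Dh\<close>
  uses the fundamental lemma of the calculus of variations.\<close>

section \<open>Smooth functions\<close>

text \<open>Weak derivatives are picked by \<open>SOME\<close> and \<open>dt\<close> is a limit in
  the \<open>L2\<close> norm, so nothing can be differentiated in time pointwise in space. Each
  conservation statement is instead paired with one fixed \<open>L2\<close> field, which yields a
  real function on \<open>I\<close> with derivative zero. In this weak form, div curl = 0 and curl
  grad = 0 both reduce to the symmetry of the second derivatives of a test function. The fundamental
  lemma needs enough test functions to recover integrals over boxes, hence the explicit smooth
  bumps. The mesh covers only \<open>closure \<Omega>\<close>. Restricting weak derivatives from
  \<Omega> to an element \<open>K\<close> relies on \<open>interior K\<close> lying in \<Omega>,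
  which can fail for a domain with a slit; the Lipschitz graph condition excludes this. The constant
  in the left-hand side of (b) is the initial mismatch
  \<open>\<rho> t0 - weak_div \<Omega> (Dh t0)\<close>, tested against \<open>\<phi>'\<close> on
  \<open>K\<close>.\<close>

lemma grad_eqI:
  assumes "(f has_derivative f') (at x)"
  shows "grad f x $ i = f' (axis i 1)"
  using frechet_derivative_at[OF assms] by (simp add: grad_def)

lemma has_derivative_grad:
  assumes "f differentiable (at x)"
  shows "(f has_derivative (\<lambda>h. grad f x \<bullet> h)) (at x)"
proof -
  let ?f' = "frechet_derivative f (at x)"
  have f': "(f has_derivative ?f') (at x)"
    using assms frechet_derivative_works by blast
  then have lin: "linear ?f'"
    by (simp add: has_derivative_linear)
  have "?f' h = grad f x \<bullet> h" for h
  proof -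
    have "?f' h = ?f' (\<Sum>i\<in>UNIV. h $ i *\<^sub>R axis i 1)"
      by (metis basis_expansion scalar_mult_eq_scaleR)
    also have "\<dots> = (\<Sum>i\<in>UNIV. h $ i *\<^sub>R ?f' (axis i 1))"
      using lin by (simp add: linear_sum linear_scale)
    also have "\<dots> = grad f x \<bullet> h"
      by (simp add: inner_vec_def grad_def mult.commute)
    finally show ?thesis .
  qed
  with f' show ?thesis
    by (metis (no_types, lifting) ext)
qed

lemma C_k_continuous: "C_k k f \<Longrightarrow> continuous_on UNIV f"
  by (cases k) (auto intro!: continuous_at_imp_continuous_on differentiable_imp_continuous_within)

lemma C_k_SucD: "C_k (Suc k) f \<Longrightarrow> C_k k f"
proof (induction k arbitrary: f)
  case 0
  then show ?case using C_k_continuous by (metis C_k.simps(1))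
next
  case (Suc k)
  then show ?case by (metis C_k.simps(2))
qed

lemma C_k_const: "C_k k (\<lambda>x. c)"
proof (induction k arbitrary: c)
  case (Suc k)
  have "grad (\<lambda>x. c) x $ i = 0" for x i
    by (rule grad_eqI) simp
  with Suc[of 0] show ?case by simp
qed simp

lemma C_k_add: "C_k k f \<Longrightarrow> C_k k g \<Longrightarrow> C_k k (\<lambda>x. f x + g x)"
proof (induction k arbitrary: f g)
  case (Suc k)
  have "grad (\<lambda>x. f x + g x) x $ i = grad f x $ i + grad g x $ i" for x i
    using Suc.prems by (subst grad_eqI[OF has_derivative_add[OF has_derivative_grad has_derivative_grad]])
      (auto simp: inner_axis)
  with Suc show ?case by (auto intro: derivative_intros)
qed (auto intro: continuous_intros)

lemma C_k_mult: "C_k k f \<Longrightarrow> C_k k g \<Longrightarrow> C_k k (\<lambda>x. f x * g x)"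
proof (induction k arbitrary: f g)
  case (Suc k)
  have "grad (\<lambda>x. f x * g x) x $ i = f x * grad g x $ i + grad f x $ i * g x" for x i
    using Suc.prems by (subst grad_eqI[OF has_derivative_mult[OF has_derivative_grad has_derivative_grad]])
      (auto simp: inner_axis)
  moreover have "C_k k (\<lambda>x. f x * grad g x $ i + grad f x $ i * g x)" for i
    using Suc.prems by (intro C_k_add Suc.IH) (auto intro: C_k_SucD)
  ultimately show ?case
    using Suc.prems by (auto intro!: differentiable_mult)
qed (auto intro: continuous_intros)

lemma C_k_prod:
  assumes "finite A" "\<And>i. i \<in> A \<Longrightarrow> C_k k (f i)"
  shows "C_k k (\<lambda>x. \<Prod>i\<in>A. f i x)"
  using assms by (induction A rule: finite_induct) (auto intro: C_k_const C_k_mult)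

section \<open>Symmetry of second partial derivatives\<close>

lemma second_difference_mean_value:
  fixes \<psi> :: "R3 \<Rightarrow> real"
  assumes "C_k 2 \<psi>" "h > 0"
  shows "\<exists>s r. 0 < s \<and> s < h \<and> 0 < r \<and> r < h \<and>
    \<psi> (x + h *\<^sub>R axis i 1 + h *\<^sub>R axis j 1) - \<psi> (x + h *\<^sub>R axis i 1) - \<psi> (x + h *\<^sub>R axis j 1) + \<psi> x
    = h\<^sup>2 * grad (\<lambda>y. grad \<psi> y $ i) (x + s *\<^sub>R axis i 1 + r *\<^sub>R axis j 1) $ j"
proof -
  have D: "\<psi> differentiable (at y)" "(\<lambda>y. grad \<psi> y $ i) differentiable (at y)" for y
    using assms(1) by (auto simp: numeral_2_eq_2)
  have d1: "((\<lambda>s. f (y + s *\<^sub>R axis k 1)) has_real_derivative grad f (y + s *\<^sub>R axis k 1) $ k) (at s)"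
    if "\<And>y. f differentiable (at y)" for f :: "R3 \<Rightarrow> real" and y k s
  proof -
    have "((\<lambda>s. y + s *\<^sub>R axis k 1) has_derivative (\<lambda>s. s *\<^sub>R axis k 1)) (at s)"
      by (auto intro!: derivative_eq_intros)
    from has_derivative_compose[OF this has_derivative_grad[OF that]]
    show ?thesis by (simp add: has_field_derivative_def inner_axis mult_commute_abs)
  qed
  \<comment> \<open>\<open>g\<close> compares two parallel segments in direction \<open>i\<close>,
    shifted by \<open>h\<close> in direction \<open>j\<close>, so \<open>g h - g 0\<close> is the
    whole second difference. The mean value theorem along \<open>i\<close> and then along
    \<open>j\<close> produces \<open>s\<close> and \<open>r\<close>.\<close>
  define g where "g s = \<psi> ((x + h *\<^sub>R axis j 1) + s *\<^sub>R axis i 1) - \<psi> (x + s *\<^sub>R axis i 1)" for s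
  have "\<exists>s>0. s < h \<and> g h - g 0 = (h - 0) *
      (grad \<psi> ((x + h *\<^sub>R axis j 1) + s *\<^sub>R axis i 1) $ i - grad \<psi> (x + s *\<^sub>R axis i 1) $ i)"
    unfolding g_def using assms(2) by (intro MVT2) (auto intro!: DERIV_diff d1 D)
  then obtain s where s: "0 < s" "s < h" "g h - g 0 = h *
      (grad \<psi> ((x + h *\<^sub>R axis j 1) + s *\<^sub>R axis i 1) $ i - grad \<psi> (x + s *\<^sub>R axis i 1) $ i)"
    by auto
  let ?y = "x + s *\<^sub>R axis i 1"
  have "\<exists>r>0. r < h \<and> grad \<psi> (?y + h *\<^sub>R axis j 1) $ i - grad \<psi> (?y + 0 *\<^sub>R axis j 1) $ i =
      (h - 0) * grad (\<lambda>y. grad \<psi> y $ i) (?y + r *\<^sub>R axis j 1) $ j"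
    using assms(2) by (intro MVT2) (auto intro!: d1 D)
  then obtain r where r: "0 < r" "r < h" "grad \<psi> (?y + h *\<^sub>R axis j 1) $ i - grad \<psi> ?y $ i =
      h * grad (\<lambda>y. grad \<psi> y $ i) (?y + r *\<^sub>R axis j 1) $ j"
    by auto
  from s r show ?thesis
    by (intro exI[of _ s] exI[of _ r]) (auto simp: g_def algebra_simps power2_eq_square)
qed

text \<open>The second difference is symmetric in \<open>i\<close> and \<open>j\<close>, whereas its
  mean value form contains the derivatives in one order or the other. Dividing by
  \<open>h\<^sup>2\<close> and taking \<open>h\<close> small compares the two orders, by continuity
  of both mixed partials at \<open>x\<close>.\<close>

lemma mixed_partials_commute:
  assumes "C_k 2 \<psi>"
  shows "grad (\<lambda>y. grad \<psi> y $ i) x $ j = grad (\<lambda>y. grad \<psi> y $ j) x $ i"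
proof -
  have lim: "\<exists>d>0. \<forall>s r. 0 < s \<longrightarrow> s < d \<longrightarrow> 0 < r \<longrightarrow> r < d \<longrightarrow>
      \<bar>grad (\<lambda>y. grad \<psi> y $ i) (x + s *\<^sub>R axis i 1 + r *\<^sub>R axis j 1) $ j
        - grad (\<lambda>y. grad \<psi> y $ i) x $ j\<bar> < e" if "e > 0" for e i j
  proof -
    have "continuous_on UNIV (\<lambda>x. grad (\<lambda>y. grad \<psi> y $ i) x $ j)"
      using assms by (auto simp: numeral_2_eq_2)
    then obtain d where d: "d > 0" "\<And>z. dist z x < d \<Longrightarrow>
        dist (grad (\<lambda>y. grad \<psi> y $ i) z $ j) (grad (\<lambda>y. grad \<psi> y $ i) x $ j) < e"
      using \<open>e > 0\<close> unfolding continuous_on_iff by (metis UNIV_I)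
    \<comment> \<open>Two displacements, each shorter than \<open>d / 2\<close>, keep the point
      within \<open>d\<close> of \<open>x\<close>.\<close>
    have "dist (x + s *\<^sub>R axis i 1 + r *\<^sub>R axis j 1) x < d"
      if "0 < s" "s < d / 2" "0 < r" "r < d / 2" for s r
    proof -
      have "norm (s *\<^sub>R axis i 1 + r *\<^sub>R axis j (1::real)) \<le> s + r"
        using norm_triangle_ineq[of "s *\<^sub>R axis i (1::real)" "r *\<^sub>R axis j (1::real)"] that by simp
      with that show ?thesis by (simp add: dist_norm add.assoc)
    qed
    with d show ?thesis
      by (intro exI[of _ "d / 2"]) (auto simp: dist_real_def)
  qed
  have "\<bar>grad (\<lambda>y. grad \<psi> y $ i) x $ j - grad (\<lambda>y. grad \<psi> y $ j) x $ i\<bar> \<le> e" if "e > 0" for e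
  proof -
    from lim[of "e/2" i j] lim[of "e/2" j i] \<open>e > 0\<close> obtain d1 d2 where d: "d1 > 0" "d2 > 0"
      "\<And>s r. 0 < s \<Longrightarrow> s < d1 \<Longrightarrow> 0 < r \<Longrightarrow> r < d1 \<Longrightarrow>
      \<bar>grad (\<lambda>y. grad \<psi> y $ i) (x + s *\<^sub>R axis i 1 + r *\<^sub>R axis j 1) $ j
        - grad (\<lambda>y. grad \<psi> y $ i) x $ j\<bar> < e/2"
      "\<And>s r. 0 < s \<Longrightarrow> s < d2 \<Longrightarrow> 0 < r \<Longrightarrow> r < d2 \<Longrightarrow>
      \<bar>grad (\<lambda>y. grad \<psi> y $ j) (x + s *\<^sub>R axis j 1 + r *\<^sub>R axis i 1) $ i
        - grad (\<lambda>y. grad \<psi> y $ j) x $ i\<bar> < e/2"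
      by auto
    define h where "h = min d1 d2"
    have h: "h > 0" "h \<le> d1" "h \<le> d2" using d by (auto simp: h_def)
    from second_difference_mean_value[OF assms h(1), of x i j]
    obtain s r where 1: "0 < s" "s < h" "0 < r" "r < h"
      "\<psi> (x + h *\<^sub>R axis i 1 + h *\<^sub>R axis j 1) - \<psi> (x + h *\<^sub>R axis i 1) - \<psi> (x + h *\<^sub>R axis j 1) + \<psi> x
      = h\<^sup>2 * grad (\<lambda>y. grad \<psi> y $ i) (x + s *\<^sub>R axis i 1 + r *\<^sub>R axis j 1) $ j"
      by blast
    from second_difference_mean_value[OF assms h(1), of x j i]
    obtain s' r' where 2: "0 < s'" "s' < h" "0 < r'" "r' < h"
      "\<psi> (x + h *\<^sub>R axis j 1 + h *\<^sub>R axis i 1) - \<psi> (x + h *\<^sub>R axis j 1) - \<psi> (x + h *\<^sub>R axis i 1) + \<psi> x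
      = h\<^sup>2 * grad (\<lambda>y. grad \<psi> y $ j) (x + s' *\<^sub>R axis j 1 + r' *\<^sub>R axis i 1) $ i"
      by blast
    \<comment> \<open>The two instances list the increments in opposite order; after this rewriting
      their left-hand sides agree.\<close>
    have comm: "x + h *\<^sub>R axis j 1 + h *\<^sub>R axis i 1 = x + h *\<^sub>R axis i 1 + h *\<^sub>R axis j 1"
      by simp
    have "h\<^sup>2 * grad (\<lambda>y. grad \<psi> y $ i) (x + s *\<^sub>R axis i 1 + r *\<^sub>R axis j 1) $ j
      = h\<^sup>2 * grad (\<lambda>y. grad \<psi> y $ j) (x + s' *\<^sub>R axis j 1 + r' *\<^sub>R axis i 1) $ i"
      using 1(5) 2(5)[unfolded comm] by linarith
    then have "grad (\<lambda>y. grad \<psi> y $ i) (x + s *\<^sub>R axis i 1 + r *\<^sub>R axis j 1) $ j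
      = grad (\<lambda>y. grad \<psi> y $ j) (x + s' *\<^sub>R axis j 1 + r' *\<^sub>R axis i 1) $ i"
      using h by simp
    moreover have "s < d1" "r < d1" "s' < d2" "r' < d2" using 1 2 h by auto
    ultimately show ?thesis
      using d(3)[OF 1(1) _ 1(3)] d(4)[OF 2(1) _ 2(3)] by (smt (verit) field_sum_of_halves)
  qed
  then have "\<bar>grad (\<lambda>y. grad \<psi> y $ i) x $ j - grad (\<lambda>y. grad \<psi> y $ j) x $ i\<bar> \<le> 0"
    by (rule field_le_epsilon[where y = 0, simplified])
  then show ?thesis by simp
qed

section \<open>Smooth bump functions supported in boxes\<close>

text \<open>The derivatives of \<open>s \<mapsto> exp (-1/s)\<close>, extended by zero, are all of this form.\<close>

definition poly_flat :: "real poly \<Rightarrow> real \<Rightarrow> real" where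
  "poly_flat p s = (if s \<le> 0 then 0 else poly p (inverse s) * exp (- inverse s))"

text \<open>With \<open>y = inverse s\<close>, decay at infinity becomes flatness of
  \<open>poly_flat\<close> at the origin from the right.\<close>

lemma poly_times_exp_tendsto_0: "((\<lambda>y::real. poly p y * exp (- y)) \<longlongrightarrow> 0) at_top"
proof -
  have "((\<lambda>y::real. \<Sum>i\<le>degree p. coeff p i * (y ^ i / exp y)) \<longlongrightarrow> (\<Sum>i\<le>degree p. coeff p i * 0)) at_top"
    by (intro tendsto_intros tendsto_power_div_exp_0)
  then show ?thesis
    by (simp add: poly_altdef exp_minus sum_distrib_right divide_inverse mult.assoc)
qed

text \<open>For \<open>s > 0\<close> the chain rule gives the factor \<open>inverse s\<close>
  squared, with a minus sign on \<open>pderiv p\<close> and a plus sign from the exponential: this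
  is \<open>monom 1 2 * (p - pderiv p)\<close> evaluated at \<open>inverse s\<close>. The family is
  thus closed under differentiation, and smoothness follows by iteration.\<close>

lemma has_field_derivative_poly_flat:
  "(poly_flat p has_field_derivative poly_flat (monom 1 2 * (p - pderiv p)) s) (at s)"
proof -
  consider "s < 0" | "s = 0" | "s > 0" by linarith
  then show ?thesis
  proof cases
    case 1
    have "((\<lambda>_. 0) has_field_derivative 0) (at s)" by simp
    moreover have "poly_flat (monom 1 2 * (p - pderiv p)) s = 0"
      using 1 by (simp add: poly_flat_def)
    moreover have "\<forall>\<^sub>F x in nhds s. poly_flat p x = 0"
      using eventually_nhds_in_open[of "{..<0}" s] 1
      by (auto simp: poly_flat_def elim!: eventually_mono)
    ultimately show ?thesis
      by (subst DERIV_cong_ev[where g = "\<lambda>_. 0"]) auto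
  next
    case 2
    have "((\<lambda>h. poly_flat p h / h) \<longlongrightarrow> 0) (at_left 0)"
    proof (rule tendsto_eventually)
      show "\<forall>\<^sub>F x in at_left 0. poly_flat p x / x = 0"
        by (auto simp: eventually_at_filter poly_flat_def)
    qed
    moreover have "((\<lambda>h. poly_flat p h / h) \<longlongrightarrow> 0) (at_right 0)"
    proof -
      \<comment> \<open>Dividing \<open>poly_flat p h\<close> by \<open>h\<close> multiplies the
        polynomial by its variable, hence \<open>pCons 0 p\<close>.\<close>
      have "((\<lambda>h. poly (pCons 0 p) (inverse h) * exp (- inverse h)) \<longlongrightarrow> 0) (at_right (0::real))"
        using poly_times_exp_tendsto_0[of "pCons 0 p"]
        by (rule filterlim_compose) (rule filterlim_inverse_at_top_right)
      moreover have "\<forall>\<^sub>F h in at_right 0. poly (pCons 0 p) (inverse h) * exp (- inverse h) = poly_flat p h / h"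
        by (auto simp: eventually_at_filter poly_flat_def field_simps)
      ultimately show ?thesis by (rule Lim_transform_eventually)
    qed
    ultimately have "((\<lambda>h. poly_flat p h / h) \<longlongrightarrow> 0) (at 0)"
      by (simp add: filterlim_split_at)
    then show ?thesis
      using 2 by (simp add: DERIV_def poly_flat_def)
  next
    case 3
    have "((\<lambda>s. poly p (inverse s) * exp (- inverse s)) has_field_derivative
        poly_flat (monom 1 2 * (p - pderiv p)) s) (at s)"
      using 3 by (auto intro!: derivative_eq_intros DERIV_chain'[OF _ poly_DERIV]
         simp: poly_flat_def poly_monom power2_eq_square algebra_simps)
    moreover have "\<forall>\<^sub>F x in nhds s. poly_flat p x = poly p (inverse x) * exp (- inverse x)"
      using eventually_nhds_in_open[of "{0<..}" s] 3
      by (auto simp: poly_flat_def elim!: eventually_mono)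
    ultimately show ?thesis
      by (subst DERIV_cong_ev[where g = "\<lambda>s. poly p (inverse s) * exp (- inverse s)"]) auto
  qed
qed

text \<open>The polynomial stays arbitrary in the induction because each derivative replaces it by
  another one. Affine functions of one coordinate are the arguments occurring in
  \<open>box_bump\<close>.\<close>

lemma C_k_poly_flat: "C_k k (\<lambda>x. poly_flat p (c * x $ i + d))"
proof (induction k arbitrary: p)
  case 0
  have "continuous_on UNIV (poly_flat p)"
    using has_field_derivative_poly_flat[of p] DERIV_isCont continuous_at_imp_continuous_on by blast
  then have "continuous_on UNIV (\<lambda>x::R3. poly_flat p (c * x $ i + d))"
    by (rule continuous_on_compose2) (auto intro!: continuous_intros)
  then show ?case by simp
next
  case (Suc k)
  let ?q = "monom 1 2 * (p - pderiv p)"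
  have der: "((\<lambda>x. poly_flat p (c * x $ i + d)) has_derivative
      (\<lambda>h. poly_flat ?q (c * x $ i + d) * (c * h $ i))) (at x)" for x :: R3
  proof -
    have "((\<lambda>x::R3. c * x $ i + d) has_derivative (\<lambda>h. c * h $ i)) (at x)"
      by (auto intro!: derivative_eq_intros bounded_linear.has_derivative[OF bounded_linear_vec_nth])
    from has_derivative_compose[OF this has_field_derivative_poly_flat[unfolded has_field_derivative_def]]
    show ?thesis .
  qed
  have "C_k k (\<lambda>x. grad (\<lambda>x. poly_flat p (c * x $ i + d)) x $ j)" for j
    unfolding grad_eqI[OF der] by (intro C_k_mult Suc C_k_const)
  with der show ?case by (auto simp: differentiable_def)
qed

text \<open>Inside the box, a face at distance \<open>s\<close> contributes the factor
  \<open>exp (- 1 / (n * s))\<close>, which increases to 1 as \<open>n\<close> grows. The arguments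
  are expanded into affine functions of a coordinate to fit \<open>C_k_poly_flat\<close>.\<close>

definition box_bump :: "R3 \<Rightarrow> R3 \<Rightarrow> nat \<Rightarrow> R3 \<Rightarrow> real" where
  "box_bump a b n x =
     (\<Prod>i\<in>UNIV. poly_flat 1 (real n * x $ i + (- real n * a $ i)) * poly_flat 1 (- real n * x $ i + real n * b $ i))"

lemma C_k_box_bump: "C_k k (box_bump a b n)"
  unfolding box_bump_def [abs_def]
proof (rule C_k_prod)
  fix i :: 3
  show "C_k k (\<lambda>x. poly_flat 1 (real n * x $ i + (- real n * a $ i)) * poly_flat 1 (- real n * x $ i + real n * b $ i))"
    by (rule C_k_mult[OF C_k_poly_flat C_k_poly_flat])
qed simp

lemma poly_flat_1_bounds: "0 \<le> poly_flat 1 s" "poly_flat 1 s \<le> 1"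
  by (auto simp: poly_flat_def)

lemma box_bump_bounds: "0 \<le> box_bump a b n x" "box_bump a b n x \<le> 1"
proof -
  have "0 \<le> poly_flat 1 s * poly_flat 1 r \<and> poly_flat 1 s * poly_flat 1 r \<le> 1" for s r
    by (meson mult_le_one mult_nonneg_nonneg poly_flat_1_bounds)
  then show "0 \<le> box_bump a b n x" "box_bump a b n x \<le> 1"
    unfolding box_bump_def by (blast intro: prod_nonneg prod_le_1)+
qed

lemma box_bump_eq_0:
  assumes "x \<notin> box a b"
  shows "box_bump a b n x = 0"
proof -
  from assms obtain i where "x $ i \<le> a $ i \<or> b $ i \<le> x $ i"
    by (auto simp: mem_box_cart not_less)
  then have "real n * x $ i + (- real n * a $ i) \<le> 0 \<or> - real n * x $ i + real n * b $ i \<le> 0"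
    by (auto intro: mult_left_mono)
  then have "poly_flat 1 (real n * x $ i + (- real n * a $ i)) * poly_flat 1 (- real n * x $ i + real n * b $ i) = 0"
    by (auto simp: poly_flat_def)
  then show ?thesis
    unfolding box_bump_def by (intro prod_zero) auto
qed

lemma box_bump_tendsto: "(\<lambda>n. box_bump a b n x) \<longlonglongrightarrow> indicator (box a b) x"
proof (cases "x \<in> box a b")
  case True
  have lim: "(\<lambda>n. poly_flat 1 (real n * s)) \<longlonglongrightarrow> 1" if "s > 0" for s
  proof -
    have "(\<lambda>n. exp (- inverse (real n * s))) \<longlonglongrightarrow> exp (- 0)"
    proof (intro tendsto_intros)
      have "(\<lambda>n. inverse (real n) * inverse s) \<longlonglongrightarrow> 0 * inverse s"
        by (intro tendsto_intros lim_inverse_n)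
      then show "(\<lambda>n. inverse (real n * s)) \<longlonglongrightarrow> 0" by simp
    qed
    \<comment> \<open>Only eventually: at \<open>n = 0\<close> the left side is
      \<open>exp 0 = 1\<close>, because \<open>inverse 0 = 0\<close>, while
      \<open>poly_flat 1 0 = 0\<close>.\<close>
    moreover have "\<forall>\<^sub>F n in sequentially. exp (- inverse (real n * s)) = poly_flat 1 (real n * s)"
      using eventually_gt_at_top[of 0]
      by eventually_elim (use that in \<open>auto simp: poly_flat_def not_less zero_less_mult_iff mult_le_0_iff\<close>)
    ultimately show ?thesis by (simp add: Lim_transform_eventually)
  qed
  have "(\<lambda>n. \<Prod>i\<in>UNIV. poly_flat 1 (real n * (x $ i - a $ i)) * poly_flat 1 (real n * (b $ i - x $ i)))
      \<longlonglongrightarrow> (\<Prod>i\<in>(UNIV::3 set). 1 * 1)"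
    using True by (intro tendsto_intros lim) (auto simp: mem_box_cart)
  then show ?thesis
    using True by (simp add: box_bump_def algebra_simps)
next
  case False
  then show ?thesis by (simp add: box_bump_eq_0)
qed

text \<open>The support can reach the faces of the box, so it is the closed box that has to lie in
  \<open>S\<close>.\<close>

lemma box_bump_test_function:
  assumes "cbox a b \<subseteq> S"
  shows "box_bump a b n \<in> test_functions S"
proof -
  have "{x. box_bump a b n x \<noteq> 0} \<subseteq> cbox a b"
    using box_bump_eq_0 box_subset_cbox by blast
  then have sub: "closure {x. box_bump a b n x \<noteq> 0} \<subseteq> cbox a b"
    using closed_cbox by (rule closure_minimal)
  then have "compact (closure {x. box_bump a b n x \<noteq> 0})"
    by (metis bounded_cbox bounded_subset closed_closure compact_eq_bounded_closed)
  with sub assms show ?thesis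
    by (auto simp: test_functions_def C_k_box_bump)
qed

text \<open>A function that vanishes on the open complement of its support has zero gradient there.
  This makes partial derivatives of test functions admissible in the weak identities, where second
  derivatives then appear.\<close>

lemma test_function_grad:
  assumes "\<psi> \<in> test_functions S"
  shows "(\<lambda>x. grad \<psi> x $ i) \<in> test_functions S"
proof -
  have C: "C_k k \<psi>" for k using assms by (simp add: test_functions_def)
  let ?C = "closure {x. \<psi> x \<noteq> 0}"
  have "grad \<psi> x $ i = 0" if "x \<notin> ?C" for x
  proof -
    have "\<psi> y = 0" if "y \<in> - ?C" for y
      using that closure_subset[of "{x. \<psi> x \<noteq> 0}"] by auto
    then have "(\<psi> has_derivative (\<lambda>_. 0)) (at x)"
      using that has_derivative_transform_within_open[of "\<lambda>_. 0" "\<lambda>_. 0" x UNIV "- ?C" \<psi>]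
      by (metis ComplI closed_closure has_derivative_const open_Compl)
    from grad_eqI[OF this] show ?thesis .
  qed
  then have "{x. grad \<psi> x $ i \<noteq> 0} \<subseteq> ?C" by blast
  then have sub: "closure {x. grad \<psi> x $ i \<noteq> 0} \<subseteq> ?C" using closed_closure by (rule closure_minimal)
  moreover have "compact ?C" "?C \<subseteq> S" using assms by (auto simp: test_functions_def)
  moreover have "C_k k (\<lambda>x. grad \<psi> x $ i)" for k
    using C[of "Suc k"] by simp
  ultimately show ?thesis
    unfolding test_functions_def using compact_Int_closed[of ?C "closure {x. grad \<psi> x $ i \<noteq> 0}"]
    by (auto simp: Int_absorb1)
qed

section \<open>Square integrable functions\<close>

text \<open>Lebesgue measure is complete, and extension by zero through the indicator transports
  this to \<open>S\<close>.\<close>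

lemma borel_measurable_lebesgue_on_AE:
  fixes f g :: "'a::euclidean_space \<Rightarrow> 'b::euclidean_space"
  assumes S: "S \<in> sets lebesgue" and f: "f \<in> borel_measurable (lebesgue_on S)"
    and ae: "AE x in lebesgue_on S. f x = g x"
  shows "g \<in> borel_measurable (lebesgue_on S)"
proof -
  have "(\<lambda>x. indicator S x *\<^sub>R f x) \<in> borel_measurable lebesgue"
    using f S by (simp add: borel_measurable_restrict_space_iff)
  moreover have "AE x in lebesgue. indicator S x *\<^sub>R f x = indicator S x *\<^sub>R g x"
    using ae S by (auto simp: AE_restrict_space_iff indicator_def)
  ultimately have "(\<lambda>x. indicator S x *\<^sub>R g x) \<in> borel_measurable lebesgue"
    by (rule borel_measurable_AE)
  then show ?thesis
    using S by (simp add: borel_measurable_restrict_space_iff)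
qed

text \<open>By completeness \<open>f\<close> and \<open>g\<close> are measurable together or not at
  all; in the second case neither is integrable and both integrals have the default value 0.
  Representatives of weak derivatives can thus be exchanged under an integral without measurability
  side conditions.\<close>

lemma integral_lebesgue_on_cong_AE:
  fixes f g :: "'a::euclidean_space \<Rightarrow> 'b::euclidean_space"
  assumes S: "S \<in> sets lebesgue" and ae: "AE x in lebesgue_on S. f x = g x"
  shows "integral\<^sup>L (lebesgue_on S) f = integral\<^sup>L (lebesgue_on S) g"
proof (cases "f \<in> borel_measurable (lebesgue_on S)")
  case True
  then show ?thesis
    using ae borel_measurable_lebesgue_on_AE[OF S True ae] by (intro integral_cong_AE)
next
  case False
  moreover have "AE x in lebesgue_on S. g x = f x" using ae by eventually_elim simp
  ultimately have "g \<notin> borel_measurable (lebesgue_on S)"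
    using S borel_measurable_lebesgue_on_AE by blast
  with False have "\<not> integrable (lebesgue_on S) f" "\<not> integrable (lebesgue_on S) g"
    by auto
  then show ?thesis
    by (simp add: not_integrable_integral_eq)
qed

lemma AE_lebesgue_on_subset:
  assumes "S \<in> sets lebesgue" "T \<in> sets lebesgue" "S \<subseteq> T" "AE x in lebesgue_on T. P x"
  shows "AE x in lebesgue_on S. P x"
proof -
  have "AE x in lebesgue. x \<in> T \<longrightarrow> P x" using assms by (simp add: AE_restrict_space_iff)
  then have "AE x in lebesgue. x \<in> S \<longrightarrow> P x" by eventually_elim (use assms in auto)
  then show ?thesis using assms by (simp add: AE_restrict_space_iff)
qed

lemma integrable_lebesgue_on_subset:
  fixes f :: "'a::euclidean_space \<Rightarrow> 'b::euclidean_space"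
  assumes S: "S \<in> sets lebesgue" and T: "T \<in> sets lebesgue" and "S \<subseteq> T"
    and f: "integrable (lebesgue_on T) f"
  shows "integrable (lebesgue_on S) f"
proof -
  have "integrable lebesgue (\<lambda>x. indicator S x *\<^sub>R (indicator T x *\<^sub>R f x))"
    using f T S by (intro integrable_mult_indicator[OF S]) (simp add: integrable_restrict_space)
  moreover have "(\<lambda>x. indicat_real S x *\<^sub>R (indicat_real T x *\<^sub>R f x)) = (\<lambda>x. indicator S x *\<^sub>R f x)"
    using \<open>S \<subseteq> T\<close> by (auto simp: indicator_def fun_eq_iff)
  ultimately have "integrable lebesgue (\<lambda>x. indicat_real S x *\<^sub>R f x)"
    by (simp only:)
  then show ?thesis
    using S by (simp add: integrable_restrict_space)
qed

lemma integral_lebesgue_on_subset: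
  fixes f :: "'a::euclidean_space \<Rightarrow> 'b::euclidean_space"
  assumes S: "S \<in> sets lebesgue" and T: "T \<in> sets lebesgue" and "S \<subseteq> T"
    and "\<And>x. x \<in> T - S \<Longrightarrow> f x = 0"
  shows "integral\<^sup>L (lebesgue_on T) f = integral\<^sup>L (lebesgue_on S) f"
proof -
  have "indicator T x *\<^sub>R f x = indicator S x *\<^sub>R f x" for x
    using assms(3,4) by (auto simp: indicator_def)
  then have "(\<integral>x. indicator T x *\<^sub>R f x \<partial>lebesgue) = (\<integral>x. indicator S x *\<^sub>R f x \<partial>lebesgue)"
    by (simp only:)
  then show ?thesis
    using S T by (simp add: integral_restrict_space)
qed

lemma L2_I:
  "f \<in> borel_measurable (lebesgue_on S) \<Longrightarrow> integrable (lebesgue_on S) (\<lambda>x. (norm (f x))\<^sup>2) \<Longrightarrow> f \<in> L2 S"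
  by (simp add: L2_def)

lemma L2_measurable: "f \<in> L2 S \<Longrightarrow> f \<in> borel_measurable (lebesgue_on S)"
  by (simp add: L2_def)

lemma L2_integrable: "f \<in> L2 S \<Longrightarrow> integrable (lebesgue_on S) (\<lambda>x. (norm (f x))\<^sup>2)"
  by (simp add: L2_def)

lemma L2_bounded_linear:
  assumes "f \<in> L2 S" "bounded_linear T"
  shows "(\<lambda>x. T (f x)) \<in> L2 S"
proof -
  from assms(2) obtain K where K: "\<And>x. norm (T x) \<le> norm x * K"
    using bounded_linear.pos_bounded by blast
  have meas: "(\<lambda>x. T (f x)) \<in> borel_measurable (lebesgue_on S)"
    using L2_measurable[OF assms(1)] bounded_linear.continuous_on[OF assms(2) continuous_on_id]
    by (metis borel_measurable_continuous_onI measurable_compose)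
  show ?thesis
  proof (rule L2_I[OF meas], rule Bochner_Integration.integrable_bound)
    show "integrable (lebesgue_on S) (\<lambda>x. K\<^sup>2 * (norm (f x))\<^sup>2)"
      using L2_integrable[OF assms(1)] by simp
    show "AE x in lebesgue_on S. norm ((norm (T (f x)))\<^sup>2) \<le> norm (K\<^sup>2 * (norm (f x))\<^sup>2)"
      using power_mono[OF K norm_ge_zero, where n=2] by (simp add: power_mult_distrib mult.commute)
  qed (use meas in measurable)
qed

lemma L2_add:
  fixes f g :: "R3 \<Rightarrow> 'b::euclidean_space"
  assumes "f \<in> L2 S" "g \<in> L2 S"
  shows "(\<lambda>x. f x + g x) \<in> L2 S"
proof -
  note [measurable] = L2_measurable[OF assms(1)] L2_measurable[OF assms(2)]
  show ?thesis
  proof (rule L2_I, measurable, rule Bochner_Integration.integrable_bound)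
    show "integrable (lebesgue_on S) (\<lambda>x. 2 * (norm (f x))\<^sup>2 + 2 * (norm (g x))\<^sup>2)"
      using assms[THEN L2_integrable] by simp
    have "(norm (a + b))\<^sup>2 \<le> 2 * (norm a)\<^sup>2 + 2 * (norm b)\<^sup>2" for a b :: 'b
      using power_mono[OF norm_triangle_ineq[of a b] norm_ge_zero, of 2]
        sum_squares_bound[of "norm a" "norm b"] by (simp add: power2_sum)
    then show "AE x in lebesgue_on S. norm ((norm (f x + g x))\<^sup>2) \<le> norm (2 * (norm (f x))\<^sup>2 + 2 * (norm (g x))\<^sup>2)"
      by simp
  qed measurable
qed

lemma L2_scaleR: "f \<in> L2 S \<Longrightarrow> (\<lambda>x. c *\<^sub>R f x) \<in> L2 S"
  by (rule L2_bounded_linear[OF _ bounded_linear_scaleR_right])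

lemma L2_diff: "f \<in> L2 S \<Longrightarrow> g \<in> L2 S \<Longrightarrow> (\<lambda>x. f x - g x) \<in> L2 S"
  using L2_add[OF _ L2_scaleR[of g S "-1"]] by simp

lemma L2_0: "(\<lambda>x. 0) \<in> L2 S"
  by (simp add: L2_def)

lemma L2_sum: "(\<And>i. i \<in> A \<Longrightarrow> f i \<in> L2 S) \<Longrightarrow> (\<lambda>x. \<Sum>i\<in>A. f i x) \<in> L2 S"
  by (induction A rule: infinite_finite_induct) (auto intro: L2_add L2_0)

lemma L2_component: "f \<in> L2 S \<Longrightarrow> (\<lambda>x. f x $ i) \<in> L2 S"
  by (rule L2_bounded_linear[OF _ bounded_linear_vec_nth])

lemma L2_vec:
  fixes f :: "R3 \<Rightarrow> R3"
  assumes "\<And>i. (\<lambda>x. f x $ i) \<in> L2 S"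
  shows "f \<in> L2 S"
proof -
  have "(\<lambda>x. \<Sum>i\<in>UNIV. f x $ i *\<^sub>R axis i (1::real)) \<in> L2 S"
    using assms by (intro L2_sum L2_bounded_linear[OF _ bounded_linear_scaleR_left])
  moreover have "(\<Sum>i\<in>UNIV. f x $ i *\<^sub>R axis i 1) = f x" for x
    by (metis basis_expansion scalar_mult_eq_scaleR)
  ultimately show ?thesis by simp
qed

lemma L2_subset:
  assumes "f \<in> L2 T" "S \<in> sets lebesgue" "T \<in> sets lebesgue" "S \<subseteq> T"
  shows "f \<in> L2 S"
  using assms by (auto simp: L2_def intro: measurable_restrict_mono integrable_lebesgue_on_subset)

lemma L2_norm_subset:
  assumes "f \<in> L2 T" "S \<in> sets lebesgue" "T \<in> sets lebesgue" "S \<subseteq> T"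
  shows "L2_norm S f \<le> L2_norm T f"
proof -
  have "(\<integral>x. indicator S x *\<^sub>R (norm (f x))\<^sup>2 \<partial>lebesgue) \<le> (\<integral>x. indicator T x *\<^sub>R (norm (f x))\<^sup>2 \<partial>lebesgue)"
  proof (rule integral_mono)
    show "integrable lebesgue (\<lambda>x. indicat_real S x *\<^sub>R (norm (f x))\<^sup>2)"
      "integrable lebesgue (\<lambda>x. indicat_real T x *\<^sub>R (norm (f x))\<^sup>2)"
      using L2_integrable[OF assms(1)] L2_integrable[OF L2_subset[OF assms]] assms
      by (simp_all add: integrable_restrict_space)
  qed (use assms(4) in \<open>auto simp: indicator_def\<close>)
  then show ?thesis
    using assms by (simp add: L2_norm_def integral_restrict_space)
qed

lemma L2_norm_cong_AE:
  fixes f g :: "R3 \<Rightarrow> 'b::euclidean_space"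
  assumes "S \<in> sets lebesgue" "AE x in lebesgue_on S. f x = g x"
  shows "L2_norm S f = L2_norm S g"
  unfolding L2_norm_def
  by (rule arg_cong[where f = sqrt], rule integral_lebesgue_on_cong_AE)
    (use assms(1) in simp, rule eventually_mono[OF assms(2)], simp)

lemma integrable_L2_scaleR:
  assumes "\<psi> \<in> L2 S" "f \<in> L2 S"
  shows "integrable (lebesgue_on S) (\<lambda>x. \<psi> x *\<^sub>R f x)"
proof -
  note [measurable] = L2_measurable[OF assms(1)] L2_measurable[OF assms(2)]
  show ?thesis
  proof (rule Bochner_Integration.integrable_bound)
    show "integrable (lebesgue_on S) (\<lambda>x. (norm (\<psi> x))\<^sup>2 + (norm (f x))\<^sup>2)"
      using assms[THEN L2_integrable] by simp
    have "\<bar>a\<bar> * b \<le> a\<^sup>2 + b\<^sup>2" for a b :: real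
    proof -
      have "2 * \<bar>a\<bar> * b \<le> a\<^sup>2 + b\<^sup>2"
        using sum_squares_bound[of "\<bar>a\<bar>" b] by simp
      moreover have "0 \<le> a\<^sup>2 + b\<^sup>2" by simp
      ultimately show ?thesis by linarith
    qed
    then show "AE x in lebesgue_on S. norm (\<psi> x *\<^sub>R f x) \<le> norm ((norm (\<psi> x))\<^sup>2 + (norm (f x))\<^sup>2)"
      by simp
  qed measurable
qed

lemma integrable_L2_inner:
  fixes f g :: "R3 \<Rightarrow> 'b::euclidean_space"
  assumes "f \<in> L2 S" "g \<in> L2 S"
  shows "integrable (lebesgue_on S) (\<lambda>x. f x \<bullet> g x)"
proof -
  note [measurable] = L2_measurable[OF assms(1)] L2_measurable[OF assms(2)]
  have norm: "(\<lambda>x. norm (h x)) \<in> L2 S" if "h \<in> L2 S" for h :: "R3 \<Rightarrow> 'b"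
    using that L2_measurable[OF that] by (simp add: L2_def)
  have "integrable (lebesgue_on S) (\<lambda>x. norm (f x) *\<^sub>R norm (g x))"
    by (intro integrable_L2_scaleR norm assms)
  then show ?thesis
    by (rule Bochner_Integration.integrable_bound) (measurable, auto simp: Cauchy_Schwarz_ineq2)
qed

section \<open>Inner products and norm inequalities for square integrable functions\<close>

lemma L2_norm_power2: "(L2_norm S f)\<^sup>2 = (\<integral>x. f x \<bullet> f x \<partial>lebesgue_on S)"
  by (simp add: L2_norm_def power2_norm_eq_inner)

lemma L2_norm_nonneg: "0 \<le> L2_norm S f"
  by (simp add: L2_norm_def)

lemma L2_norm_scaleR: "L2_norm S (\<lambda>x. c *\<^sub>R f x) = \<bar>c\<bar> * L2_norm S f"
  by (simp add: L2_norm_def power_mult_distrib real_sqrt_mult)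

lemma L2_norm_add_power2:
  assumes "f \<in> L2 S" "g \<in> L2 S"
  shows "(L2_norm S (\<lambda>x. f x + g x))\<^sup>2 =
    (L2_norm S f)\<^sup>2 + 2 * (\<integral>x. f x \<bullet> g x \<partial>lebesgue_on S) + (L2_norm S g)\<^sup>2"
proof -
  have "(\<integral>x. (f x + g x) \<bullet> (f x + g x) \<partial>lebesgue_on S) =
      (\<integral>x. f x \<bullet> f x + 2 * (f x \<bullet> g x) + g x \<bullet> g x \<partial>lebesgue_on S)"
  proof (rule Bochner_Integration.integral_cong[OF refl])
    show "(f x + g x) \<bullet> (f x + g x) = f x \<bullet> f x + 2 * (f x \<bullet> g x) + g x \<bullet> g x" for x
      using inner_commute[of "g x" "f x"] by (simp add: inner_add_left inner_add_right)
  qed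
  also have "\<dots> = (\<integral>x. f x \<bullet> f x \<partial>lebesgue_on S) + 2 * (\<integral>x. f x \<bullet> g x \<partial>lebesgue_on S)
      + (\<integral>x. g x \<bullet> g x \<partial>lebesgue_on S)"
    using integrable_L2_inner[OF assms(1) assms(1)] integrable_L2_inner[OF assms]
      integrable_L2_inner[OF assms(2) assms(2)] by simp
  finally show ?thesis by (simp add: L2_norm_power2)
qed

text \<open>The squared norm of \<open>f + t g\<close> is a quadratic in \<open>t\<close> that is
  nonnegative for every real \<open>t\<close>. It degenerates when \<open>L2_norm S g\<close>
  vanishes, hence the two cases.\<close>

lemma L2_Cauchy_Schwarz:
  assumes "f \<in> L2 S" "g \<in> L2 S"
  shows "\<bar>\<integral>x. f x \<bullet> g x \<partial>lebesgue_on S\<bar> \<le> L2_norm S f * L2_norm S g"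
proof -
  let ?b = "\<integral>x. f x \<bullet> g x \<partial>lebesgue_on S"
  let ?a = "L2_norm S f" and ?c = "L2_norm S g"
  have q: "0 \<le> ?a\<^sup>2 + 2 * t * ?b + t\<^sup>2 * ?c\<^sup>2" for t
  proof -
    have "0 \<le> (L2_norm S (\<lambda>x. f x + t *\<^sub>R g x))\<^sup>2" by simp
    also have "\<dots> = ?a\<^sup>2 + 2 * t * ?b + t\<^sup>2 * ?c\<^sup>2"
      using L2_norm_add_power2[OF assms(1) L2_scaleR[OF assms(2)], of t]
      by (simp add: L2_norm_scaleR power_mult_distrib)
    finally show ?thesis .
  qed
  have "?b\<^sup>2 \<le> (?a * ?c)\<^sup>2"
  proof (cases "?c = 0")
    case True
    have "?b = 0"
    proof (rule ccontr)
      assume "?b \<noteq> 0"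
      \<comment> \<open>With \<open>?c = 0\<close> the quadratic is affine in \<open>t\<close>, and
        this choice of \<open>t\<close> gives it the value -1.\<close>
      then show False using q[of "- (?a\<^sup>2 + 1) / (2 * ?b)"] True by (simp add: field_simps)
    qed
    then show ?thesis by simp
  next
    case False
    \<comment> \<open>\<open>- ?b / ?c\<^sup>2\<close> is where the quadratic attains its
      minimum.\<close>
    have "?a\<^sup>2 + 2 * (- ?b / ?c\<^sup>2) * ?b + (- ?b / ?c\<^sup>2)\<^sup>2 * ?c\<^sup>2 = ?a\<^sup>2 - ?b\<^sup>2 / ?c\<^sup>2"
      using False by (simp add: field_simps power2_eq_square)
    then have "?b\<^sup>2 / ?c\<^sup>2 \<le> ?a\<^sup>2"
      using q[of "- ?b / ?c\<^sup>2"] by linarith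
    then show ?thesis
      using False by (simp add: pos_divide_le_eq power_mult_distrib)
  qed
  then have "\<bar>?b\<bar> \<le> \<bar>?a * ?c\<bar>"
    by (simp only: abs_le_square_iff)
  then show ?thesis
    by (simp add: abs_mult L2_norm_nonneg)
qed

lemma L2_norm_triangle:
  assumes "f \<in> L2 S" "g \<in> L2 S"
  shows "L2_norm S (\<lambda>x. f x + g x) \<le> L2_norm S f + L2_norm S g"
proof (rule power2_le_imp_le)
  show "(L2_norm S (\<lambda>x. f x + g x))\<^sup>2 \<le> (L2_norm S f + L2_norm S g)\<^sup>2"
    using L2_norm_add_power2[OF assms] L2_Cauchy_Schwarz[OF assms] by (simp add: power2_sum)
qed (simp add: L2_norm_nonneg)

lemma continuous_compact_support_L2:
  fixes f :: "R3 \<Rightarrow> real"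
  assumes cont: "continuous_on UNIV f" and comp: "compact (closure {x. f x \<noteq> 0})"
    and T: "T \<in> sets lebesgue"
  shows "f \<in> L2 T"
proof -
  let ?C = "closure {x. f x \<noteq> 0}"
  have "compact (f ` ?C)"
    using cont comp by (metis compact_continuous_image continuous_on_subset subset_UNIV)
  then obtain M where M: "\<And>x. x \<in> ?C \<Longrightarrow> \<bar>f x\<bar> \<le> M"
    using compact_imp_bounded[of "f ` ?C"] by (force simp: bounded_iff)
  have meas: "f \<in> borel_measurable lebesgue"
    using borel_measurable_continuous_onI[OF cont] by (intro measurable_completion) simp
  have "integrable lebesgue (\<lambda>x. (norm (f x))\<^sup>2)"
  proof (rule Bochner_Integration.integrable_bound)
    show "integrable lebesgue (\<lambda>x. indicator ?C x *\<^sub>R M\<^sup>2)"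
      using emeasure_compact_finite[OF comp]
      by (intro integrable_scaleR_left integrable_real_indicator) auto
    show "AE x in lebesgue. norm ((norm (f x))\<^sup>2) \<le> norm (indicator ?C x *\<^sub>R M\<^sup>2)"
    proof (rule AE_I2)
      fix x
      show "norm ((norm (f x))\<^sup>2) \<le> norm (indicator ?C x *\<^sub>R M\<^sup>2)"
      proof (cases "x \<in> ?C")
        case True
        with M[OF True] show ?thesis by (simp add: abs_le_square_iff[symmetric])
      next
        case False
        then have "f x = 0" using closure_subset[of "{x. f x \<noteq> 0}"] by auto
        then show ?thesis by simp
      qed
    qed
  qed (use meas in measurable)
  with meas have "f \<in> L2 UNIV" by (simp add: L2_def lebesgue_on_UNIV_eq)
  then show ?thesis using T by (auto intro: L2_subset)
qed

lemma test_function_continuous: "\<psi> \<in> test_functions S \<Longrightarrow> continuous_on UNIV \<psi>"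
  unfolding test_functions_def using C_k_continuous by blast

lemma test_function_L2:
  assumes "\<psi> \<in> test_functions S" "T \<in> sets lebesgue"
  shows "\<psi> \<in> L2 T"
proof (rule continuous_compact_support_L2)
  show "compact (closure {x. \<psi> x \<noteq> 0})"
    using assms(1) unfolding test_functions_def by blast
qed (use assms test_function_continuous in auto)

lemma test_function_grad_L2: "\<psi> \<in> test_functions S \<Longrightarrow> T \<in> sets lebesgue \<Longrightarrow> grad \<psi> \<in> L2 T"
  by (intro L2_vec test_function_L2 test_function_grad)

lemma test_function_eq_0: "\<psi> \<in> test_functions S \<Longrightarrow> x \<notin> S \<Longrightarrow> \<psi> x = 0"
  unfolding test_functions_def using closure_subset[of "{x. \<psi> x \<noteq> 0}"] by blast

lemma test_function_grad_eq_0: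
  assumes "\<psi> \<in> test_functions S" "x \<notin> S"
  shows "grad \<psi> x = 0"
  using test_function_eq_0[OF test_function_grad[OF assms(1)] assms(2)] by (simp add: vec_eq_iff)

lemma test_functions_mono: "S \<subseteq> T \<Longrightarrow> test_functions S \<subseteq> test_functions T"
  unfolding test_functions_def by blast

section \<open>The fundamental lemma of the calculus of variations\<close>

text \<open>Boxes form an intersection-stable generator of the Borel sets, so a Dynkin argument
  spreads the vanishing of the integrals from boxes to all Borel sets, and a function with this
  property is zero almost everywhere.\<close>

lemma AE_eq_0_if_box_integrals_eq_0:
  fixes g :: "'a::euclidean_space \<Rightarrow> real"
  assumes g: "integrable lebesgue g"
    and box: "\<And>a b. (\<integral>x. indicator (box a b) x *\<^sub>R g x \<partial>lebesgue) = 0"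
  shows "AE x in lebesgue. g x = 0"
proof -
  \<comment> \<open>Boxes generate only the Borel sets, so the argument runs for a Borel
    representative \<open>h\<close> on \<open>lborel\<close> and returns to \<open>g\<close> at the
    end.\<close>
  obtain h where h[measurable]: "h \<in> borel_measurable lborel" and ae: "AE x in lborel. g x = h x"
    using completion_ex_borel_measurable_real[OF borel_measurable_integrable[OF g]] by blast
  have ae': "AE x in lebesgue. g x = h x" using ae by (rule AE_completion)
  have hm: "h \<in> borel_measurable lebesgue" using h by (rule measurable_completion)
  have "integrable lebesgue h"
    using g hm by (rule integrable_cong_AE_imp) (rule eventually_mono[OF ae'], simp)
  then have int_h: "integrable lborel h" by (simp add: integrable_completion)
  have set_h: "integrable lborel (\<lambda>x. indicator A x *\<^sub>R h x)" if "A \<in> sets borel" for A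
    using that int_h by (intro integrable_mult_indicator) auto
  have box_h: "(\<integral>x. indicator (box a b) x *\<^sub>R h x \<partial>lborel) = 0" for a b
  proof -
    have "(\<integral>x. indicator (box a b) x *\<^sub>R h x \<partial>lborel) = (\<integral>x. indicator (box a b) x *\<^sub>R h x \<partial>lebesgue)"
      by (rule integral_completion[symmetric]) measurable
    also have "\<dots> = (\<integral>x. indicator (box a b) x *\<^sub>R g x \<partial>lebesgue)"
    proof (rule integral_cong_AE)
      show "(\<lambda>x. indicat_real (box a b) x *\<^sub>R h x) \<in> borel_measurable lebesgue"
        by (rule measurable_completion) measurable
      show "(\<lambda>x. indicat_real (box a b) x *\<^sub>R g x) \<in> borel_measurable lebesgue"
        by (rule borel_measurable_scaleR[OF borel_measurable_indicator borel_measurable_integrable[OF g]]) simp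
    qed (rule eventually_mono[OF ae'], simp)
    finally show ?thesis using box by simp
  qed
  \<comment> \<open>The whole space is not a box; exhausting it by boxes gives total integral zero,
    which the complement case of the induction requires.\<close>
  have lim: "(\<lambda>n. \<integral>x. indicator (box (- (real n *\<^sub>R One)) (real n *\<^sub>R One)) x *\<^sub>R h x \<partial>lborel)
      \<longlonglongrightarrow> (\<integral>x. h x \<partial>lborel)"
  proof (rule integral_dominated_convergence)
    show "integrable lborel (\<lambda>x. \<bar>h x\<bar>)" using int_h by simp
    show "AE x in lborel. (\<lambda>n. indicat_real (box (- (real n *\<^sub>R One)) (real n *\<^sub>R One)) x *\<^sub>R h x) \<longlonglongrightarrow> h x"
    proof (rule AE_I2)
      fix x :: 'a
      obtain n0 :: nat where n0: "infnorm x < real n0" using reals_Archimedean2 by blast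
      have "\<forall>\<^sub>F n in sequentially. indicat_real (box (- (real n *\<^sub>R One)) (real n *\<^sub>R One)) x *\<^sub>R h x = h x"
        using eventually_ge_at_top[of n0]
      proof eventually_elim
        case (elim n)
        have "\<bar>x \<bullet> b\<bar> < real n" if "b \<in> Basis" for b
          using Basis_le_infnorm[OF that, of x] n0 elim by linarith
        then have "x \<in> box (- (real n *\<^sub>R One)) (real n *\<^sub>R One)"
          by (auto simp: mem_box abs_less_iff minus_less_iff)
        then show ?case by simp
      qed
      then show "(\<lambda>n. indicat_real (box (- (real n *\<^sub>R One)) (real n *\<^sub>R One)) x *\<^sub>R h x) \<longlonglongrightarrow> h x"
        by (rule tendsto_eventually)
    qed
    show "AE x in lborel. norm (indicat_real (box (- (real n *\<^sub>R One)) (real n *\<^sub>R One)) x *\<^sub>R h x) \<le> \<bar>h x\<bar>" for n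
      by (auto simp: indicator_def)
  qed measurable
  then have total: "(\<integral>x. h x \<partial>lborel) = 0"
    unfolding box_h by (simp add: LIMSEQ_const_iff)
  have sets_h: "(\<integral>x. indicator A x *\<^sub>R h x \<partial>lborel) = 0" if "A \<in> sets borel" for A
  proof -
    let ?E = "range (\<lambda>(a, b). box a b :: 'a set)"
    have borel: "sets borel = sigma_sets UNIV ?E" by (simp add: borel_eq_box)
    have stable: "Int_stable ?E" by (auto simp: Int_stable_def box_Int_box)
    have closed: "?E \<subseteq> Pow UNIV" by simp
    from that have "A \<in> sigma_sets UNIV ?E" by (simp add: borel)
    with stable closed show ?thesis
    proof (induction rule: sigma_sets_induct_disjoint)
      case (compl A)
      have "indicator (UNIV - A) x *\<^sub>R h x = h x - indicator A x *\<^sub>R h x" for x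
        by (simp add: indicator_def)
      then show ?case
        using compl int_h set_h[of A] total by (simp add: borel)
    next
      case (union A)
      have "\<And>i. A i \<in> sets borel" using union by (auto simp: borel)
      moreover have "\<And>i j. i \<noteq> j \<Longrightarrow> A i \<inter> A j = {}"
        using union(1) by (auto simp: disjoint_family_on_def)
      moreover have "set_integrable lborel (\<Union>i. A i) h"
        unfolding set_integrable_def by (rule set_h, rule sets.countable_UN) (use calculation(1) in auto)
      ultimately have "(LINT x:(\<Union>i. A i)|lborel. h x) = (\<Sum>i. (LINT x:(A i)|lborel. h x))"
        by (intro lebesgue_integral_countable_add) auto
      then show ?case using union by (simp add: set_lebesgue_integral_def)
    next
      case (basic A)
      then obtain a b where "A = box a b" by auto
      then show ?case by (simp only: box_h)
    qed simp
  qed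
  have "AE x in lborel. h x = 0"
    using sets_h[unfolded real_scaleR_def] by (intro density_unique_real int_h) (simp_all add: set_lebesgue_integral_def)
  then have "AE x in lebesgue. h x = 0" by (rule AE_completion)
  with ae' show ?thesis by eventually_elim simp
qed

text \<open>The bumps converge boundedly to the indicator of a box, so dominated convergence yields
  zero integrals over boxes whose closed version lies in \<open>S\<close>. Countably many closed
  boxes then cover \<open>S\<close>.\<close>

lemma fundamental_lemma_real:
  assumes "open S" and f: "f \<in> L2 S"
    and test: "\<And>\<psi>. \<psi> \<in> test_functions S \<Longrightarrow> (\<integral>x. \<psi> x * f x \<partial>lebesgue_on S) = 0"
  shows "AE x in lebesgue_on S. f x = (0::real)"
proof -
  have S: "S \<in> sets lebesgue" using \<open>open S\<close> by simp
  have box: "AE x in lebesgue. x \<in> cbox a b \<longrightarrow> f x = 0" if ab: "cbox a b \<subseteq> S" for a b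
  proof -
    have sub: "box c d \<subseteq> cbox c d" for c d :: R3 by (rule box_subset_cbox)
    \<comment> \<open>As a product of two \<open>L2\<close> functions, the indicator of the closed
      box times \<open>f\<close> is integrable; its absolute value is the majorant for dominated
      convergence.\<close>
    have ind_L2: "indicat_real (cbox c d) \<in> L2 S" if "cbox c d \<subseteq> S" for c d
    proof -
      have "integrable lebesgue (indicat_real (cbox c d))"
        by (intro integrable_real_indicator) (auto simp: emeasure_lborel_cbox_eq)
      moreover have "(norm (indicat_real (cbox c d) x))\<^sup>2 = indicat_real (cbox c d) x" for x
        by (cases "x \<in> cbox c d") auto
      ultimately have "indicat_real (cbox c d) \<in> L2 UNIV"
        by (intro L2_I borel_measurable_indicator) (simp_all only: lebesgue_on_UNIV_eq, simp)
      then show ?thesis using S by (auto intro: L2_subset)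
    qed
    have int0: "(\<integral>x. indicator (box c d) x *\<^sub>R f x \<partial>lebesgue) = 0" if cd: "cbox c d \<subseteq> S" for c d
    proof -
      have "(\<lambda>n. \<integral>x. box_bump c d n x * f x \<partial>lebesgue_on S)
          \<longlonglongrightarrow> (\<integral>x. indicator (box c d) x * f x \<partial>lebesgue_on S)"
      proof (rule integral_dominated_convergence)
        show "integrable (lebesgue_on S) (\<lambda>x. \<bar>indicator (cbox c d) x * f x\<bar>)"
          using integrable_L2_scaleR[OF ind_L2[OF cd] f] by simp
        show "(\<lambda>x. indicat_real (box c d) x * f x) \<in> borel_measurable (lebesgue_on S)"
        proof (rule borel_measurable_times[OF borel_measurable_indicator L2_measurable[OF f]])
          show "box c d \<in> sets (lebesgue_on S)"
            using cd sub[of c d] S by (auto simp: sets_restrict_space_iff)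
        qed
        show "(\<lambda>x. box_bump c d n x * f x) \<in> borel_measurable (lebesgue_on S)" for n
          using L2_measurable[OF f] L2_measurable[OF test_function_L2[OF box_bump_test_function[OF cd] S]]
          by (intro borel_measurable_times)
        show "AE x in lebesgue_on S. (\<lambda>n. box_bump c d n x * f x) \<longlonglongrightarrow> indicat_real (box c d) x * f x"
          by (intro AE_I2 tendsto_mult_right box_bump_tendsto)
        show "AE x in lebesgue_on S. norm (box_bump c d n x * f x) \<le> \<bar>indicator (cbox c d) x * f x\<bar>" for n
        proof (rule AE_I2)
          fix x
          have "\<bar>box_bump c d n x\<bar> \<le> indicator (cbox c d) x"
            using box_bump_bounds[of c d n x] box_bump_eq_0[of x c d n] sub[of c d]
            by (auto simp: indicator_def)
          then show "norm (box_bump c d n x * f x) \<le> \<bar>indicator (cbox c d) x * f x\<bar>"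
            by (simp add: abs_mult mult_right_mono)
        qed
      qed
      then have "(\<integral>x. indicator (box c d) x * f x \<partial>lebesgue_on S) = 0"
        using test[OF box_bump_test_function[OF cd]] by (simp add: LIMSEQ_const_iff)
      moreover have "indicat_real S x * (indicator (box c d) x * f x) = indicator (box c d) x * f x" for x
        using cd sub[of c d] by (auto simp: indicator_def)
      ultimately show ?thesis
        using S by (simp add: integral_restrict_space)
    qed
    \<comment> \<open>The values of \<open>f\<close> outside \<open>S\<close> are arbitrary. Cutting
      off to one box gives a function integrable on the whole space, and intersecting it with
      another box leaves a box inside \<open>S\<close>.\<close>
    define g where "g x = indicator (box a b) x *\<^sub>R f x" for x
    have "AE x in lebesgue. g x = 0"
    proof (rule AE_eq_0_if_box_integrals_eq_0)
      have "integrable lebesgue (\<lambda>x. indicator S x *\<^sub>R (indicator (cbox a b) x *\<^sub>R f x))"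
        using integrable_L2_scaleR[OF ind_L2[OF ab] f] S by (simp add: integrable_restrict_space)
      then have "integrable lebesgue (\<lambda>x. indicat_real (box a b) x *\<^sub>R (indicator S x *\<^sub>R (indicator (cbox a b) x *\<^sub>R f x)))"
        by (intro integrable_mult_indicator[of "box a b"]) simp
      moreover have "indicat_real (box a b) x *\<^sub>R (indicator S x *\<^sub>R (indicator (cbox a b) x *\<^sub>R f x)) = g x" for x
        using ab sub[of a b] by (auto simp: g_def indicator_def)
      ultimately show "integrable lebesgue g" by simp
      fix c d :: R3
      obtain p q where pq: "box c d \<inter> box a b = box p q" by (auto simp: box_Int_box)
      then have mem: "x \<in> box p q \<longleftrightarrow> x \<in> box c d \<and> x \<in> box a b" for x
        by (simp flip: pq)
      show "(\<integral>x. indicator (box c d) x *\<^sub>R g x \<partial>lebesgue) = 0"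
      \<comment> \<open>The empty case is separate: \<open>cbox p q\<close> can then be a nonempty
        degenerate box that is not the closure of \<open>box p q\<close>, so its inclusion in
        \<open>S\<close> would not follow.\<close>
      proof (cases "box p q = {}")
        case True
        then have "indicator (box c d) x *\<^sub>R g x = 0" for x
          using mem[of x] by (auto simp: g_def indicator_def)
        then show ?thesis by (simp only: Bochner_Integration.integral_zero)
      next
        case False
        then have "cbox p q = closure (box p q)" by (rule closure_box[symmetric])
        also have "\<dots> \<subseteq> cbox a b"
          using pq sub[of a b] by (intro closure_minimal closed_cbox) blast
        finally have "cbox p q \<subseteq> S" using ab by (rule order_trans)
        moreover have "indicat_real (box c d) x *\<^sub>R g x = indicator (box p q) x *\<^sub>R f x" for x
          by (simp add: g_def indicator_def mem)
        ultimately show ?thesis using int0[of p q] by (simp only:)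
      qed
    qed
    \<comment> \<open>The cutoff uses the open box; the faces missing from it form a null
      set.\<close>
    moreover have "AE x in lebesgue. x \<notin> cbox a b - box a b"
      using negligible_frontier_interval[of a b] unfolding negligible_iff_null_sets by (rule AE_not_in)
    ultimately show ?thesis
      by eventually_elim (auto simp: g_def indicator_def)
  qed
  obtain \<D> where \<D>: "countable \<D>" "\<D> \<subseteq> Pow S" "\<And>X. X \<in> \<D> \<Longrightarrow> \<exists>a b. X = cbox a b" "\<Union>\<D> = S"
    by (rule open_countable_Union_open_cbox[OF \<open>open S\<close>]) (rule that)
  have "AE x in lebesgue. \<forall>X\<in>\<D>. x \<in> X \<longrightarrow> f x = 0"
    unfolding AE_ball_countable[OF \<D>(1)]
  proof
    fix X assume X: "X \<in> \<D>"
    then obtain a b where "X = cbox a b" using \<D>(3) by blast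
    moreover have "X \<subseteq> S" using X \<D>(2) by blast
    ultimately show "AE x in lebesgue. x \<in> X \<longrightarrow> f x = 0"
      using box[of a b] by (simp only:)
  qed
  then have "AE x in lebesgue. x \<in> S \<longrightarrow> f x = 0"
    by eventually_elim (use \<D>(4) in blast)
  then show ?thesis using S by (simp add: AE_restrict_space_iff)
qed

lemma fundamental_lemma:
  fixes f :: "R3 \<Rightarrow> 'b::euclidean_space"
  assumes "open S" and f: "f \<in> L2 S"
    and test: "\<And>\<psi>. \<psi> \<in> test_functions S \<Longrightarrow> (\<integral>x. \<psi> x *\<^sub>R f x \<partial>lebesgue_on S) = 0"
  shows "AE x in lebesgue_on S. f x = 0"
proof -
  have "AE x in lebesgue_on S. f x \<bullet> b = 0" for b
  proof (rule fundamental_lemma_real[OF \<open>open S\<close>])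
    show "(\<lambda>x. f x \<bullet> b) \<in> L2 S"
      using f by (rule L2_bounded_linear) (rule bounded_linear_inner_left)
    fix \<psi> assume \<psi>: "\<psi> \<in> test_functions S"
    have "integrable (lebesgue_on S) (\<lambda>x. \<psi> x *\<^sub>R f x)"
      using f \<psi> \<open>open S\<close> by (intro integrable_L2_scaleR test_function_L2) auto
    then have "(\<integral>x. (\<psi> x *\<^sub>R f x) \<bullet> b \<partial>lebesgue_on S) = (\<integral>x. \<psi> x *\<^sub>R f x \<partial>lebesgue_on S) \<bullet> b"
      by (rule integral_inner_left)
    then show "(\<integral>x. \<psi> x * (f x \<bullet> b) \<partial>lebesgue_on S) = 0"
      using test[OF \<psi>] by simp
  qed
  then have "AE x in lebesgue_on S. \<forall>b\<in>Basis. f x \<bullet> b = 0"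
    by (subst AE_ball_countable) (auto intro: countable_finite)
  then show ?thesis
    by eventually_elim (simp add: euclidean_all_zero_iff)
qed

section \<open>Lipschitz domains and meshes\<close>

text \<open>A point of the interior of the closure outside \<Omega> would lie on the frontier, with
  points strictly below the graph arbitrarily near. The region below the graph is open and misses
  \<Omega>, hence also misses \<open>closure \<Omega>\<close>, a contradiction.\<close>

lemma lipschitz_domain_interior_closure:
  assumes "lipschitz_domain \<Omega>"
  shows "interior (closure \<Omega>) \<subseteq> \<Omega>"
proof
  fix p assume p: "p \<in> interior (closure \<Omega>)"
  show "p \<in> \<Omega>"
  proof (rule ccontr)
    assume "p \<notin> \<Omega>"
    have "open \<Omega>" using assms by (simp add: lipschitz_domain_def)
    then have "p \<in> frontier \<Omega>"
      using p \<open>p \<notin> \<Omega>\<close> interior_subset[of "closure \<Omega>"] by (auto simp: frontier_def interior_open)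
    then obtain U e L \<gamma> where U: "open U" "p \<in> U" and e: "norm e = 1"
      and \<gamma>: "L-lipschitz_on {y. y \<bullet> e = 0} \<gamma>"
      and graph: "\<Omega> \<inter> U = {x \<in> U. \<gamma> (x - (x \<bullet> e) *\<^sub>R e) < x \<bullet> e}"
      using assms unfolding lipschitz_domain_def by blast
    have ee: "e \<bullet> e = 1" using e by (simp add: norm_eq_1)
    \<comment> \<open>On \<open>U\<close>, \<Omega> is the set where \<open>f\<close> is negative;
      positive values of \<open>f\<close> mean strictly below the graph.\<close>
    define f where "f x = \<gamma> (x - (x \<bullet> e) *\<^sub>R e) - x \<bullet> e" for x
    have cont: "continuous_on UNIV f"
      unfolding f_def
    proof (intro continuous_intros)
      show "continuous_on UNIV (\<lambda>x. \<gamma> (x - (x \<bullet> e) *\<^sub>R e))"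
        by (rule continuous_on_compose2[OF lipschitz_on_continuous_on[OF \<gamma>]])
          (auto intro!: continuous_intros simp: inner_diff_left ee)
    qed
    let ?W = "U \<inter> interior (closure \<Omega>)"
    have "open ?W" "p \<in> ?W" using U p by auto
    then obtain r where r: "r > 0" "ball p r \<subseteq> ?W" by (meson open_contains_ball)
    \<comment> \<open>Moving against \<open>e\<close> keeps the argument of \<open>\<gamma>\<close>
      and raises \<open>f\<close> by the distance moved; the distance \<open>r / 2\<close> stays
      within the ball.\<close>
    define q where "q = p - (r / 2) *\<^sub>R e"
    have "dist p q = r / 2" using r(1) e by (simp add: q_def dist_norm)
    then have qW: "q \<in> ?W" using r by auto
    have "p \<notin> {x \<in> U. \<gamma> (x - (x \<bullet> e) *\<^sub>R e) < x \<bullet> e}"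
      using graph \<open>p \<notin> \<Omega>\<close> by blast
    then have "f p \<ge> 0" using U by (simp add: f_def not_less)
    moreover have "f q = f p + r / 2"
      by (simp add: f_def q_def inner_diff_left ee algebra_simps)
    ultimately have "f q > 0" using r(1) by simp
    have "open (?W \<inter> {x. 0 < f x})"
      using \<open>open ?W\<close> open_Collect_less[OF continuous_on_const cont] by blast
    moreover have "(?W \<inter> {x. 0 < f x}) \<inter> \<Omega> = {}"
    proof -
      have "f x < 0" if "x \<in> \<Omega>" "x \<in> U" for x
      proof -
        have "x \<in> {x \<in> U. \<gamma> (x - (x \<bullet> e) *\<^sub>R e) < x \<bullet> e}" using that graph by blast
        then show ?thesis by (simp add: f_def)
      qed
      then show ?thesis by fastforce
    qed
    ultimately have "(?W \<inter> {x. 0 < f x}) \<inter> closure \<Omega> = {}"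
      using open_Int_closure_eq_empty by blast
    moreover have "q \<in> closure \<Omega>" using qW interior_subset by blast
    ultimately show False using qW \<open>f q > 0\<close> by blast
  qed
qed

lemma mesh_interior_subset:
  assumes "lipschitz_domain \<Omega>" "tetrahedral_mesh \<Omega> \<T>" "K \<in> \<T>"
  shows "interior K \<subseteq> \<Omega>"
proof -
  have "K \<subseteq> closure \<Omega>" using assms(2,3) by (auto simp: tetrahedral_mesh_def)
  then have "interior K \<subseteq> interior (closure \<Omega>)" by (rule interior_mono)
  then show ?thesis using lipschitz_domain_interior_closure[OF assms(1)] by blast
qed

section \<open>Weak derivatives\<close>

text \<open>The fundamental lemma applies to \<open>c - d\<close>. This makes the choices by
  \<open>SOME\<close> harmless: any field with the defining identity can stand in for the chosen one
  under an integral.\<close>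

lemma weak_derivative_unique:
  fixes c d :: "R3 \<Rightarrow> 'b::euclidean_space"
  assumes "open S" "c \<in> L2 S" "d \<in> L2 S"
    and "\<And>\<psi>. \<psi> \<in> test_functions S \<Longrightarrow>
      (\<integral>x. \<psi> x *\<^sub>R c x \<partial>lebesgue_on S) = (\<integral>x. \<psi> x *\<^sub>R d x \<partial>lebesgue_on S)"
  shows "AE x in lebesgue_on S. c x = d x"
proof -
  have "AE x in lebesgue_on S. c x - d x = 0"
  proof (rule fundamental_lemma[OF assms(1) L2_diff[OF assms(2,3)]])
    fix \<psi> assume \<psi>: "\<psi> \<in> test_functions S"
    then have "\<psi> \<in> L2 S" using assms(1) by (intro test_function_L2) auto
    then show "(\<integral>x. \<psi> x *\<^sub>R (c x - d x) \<partial>lebesgue_on S) = 0"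
      using assms(4)[OF \<psi>] integrable_L2_scaleR[OF _ assms(2)] integrable_L2_scaleR[OF _ assms(3)]
      by (simp add: scaleR_diff_right)
  qed
  then show ?thesis by eventually_elim simp
qed

lemma has_weak_grad_weak_grad: "f \<in> H1 S \<Longrightarrow> has_weak_grad S f (weak_grad S f)"
  unfolding weak_grad_def H1_def using someI_ex[of "has_weak_grad S f"] by blast

lemma has_weak_curl_weak_curl: "u \<in> Hcurl S \<Longrightarrow> has_weak_curl S u (weak_curl S u)"
  unfolding weak_curl_def Hcurl_def using someI_ex[of "has_weak_curl S u"] by blast

lemma has_weak_div_weak_div: "u \<in> Hdiv S \<Longrightarrow> has_weak_div S u (weak_div S u)"
  unfolding weak_div_def Hdiv_def using someI_ex[of "has_weak_div S u"] by blast

lemma weak_grad_AE: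
  assumes "open S" "has_weak_grad S f g"
  shows "AE x in lebesgue_on S. weak_grad S f x = g x"
proof -
  have "has_weak_grad S f (weak_grad S f)"
    unfolding weak_grad_def by (rule someI[of "has_weak_grad S f", OF assms(2)])
  with assms show ?thesis
    by (intro weak_derivative_unique) (auto simp: has_weak_grad_def)
qed

lemma weak_curl_AE:
  assumes "open S" "has_weak_curl S u c"
  shows "AE x in lebesgue_on S. weak_curl S u x = c x"
proof -
  have "has_weak_curl S u (weak_curl S u)"
    unfolding weak_curl_def by (rule someI[of "has_weak_curl S u", OF assms(2)])
  with assms show ?thesis
    by (intro weak_derivative_unique) (auto simp: has_weak_curl_def)
qed

lemma weak_div_AE:
  assumes "open S" "has_weak_div S u d"
  shows "AE x in lebesgue_on S. weak_div S u x = d x"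
proof -
  have "has_weak_div S u (weak_div S u)"
    unfolding weak_div_def by (rule someI[of "has_weak_div S u", OF assms(2)])
  with assms show ?thesis
    by (intro weak_derivative_unique) (auto simp: has_weak_div_def)
qed

lemma integral_test_subset:
  fixes F :: "R3 \<Rightarrow> 'b::euclidean_space"
  assumes "open S" "open T" "S \<subseteq> T" "\<And>x. x \<notin> S \<Longrightarrow> F x = 0"
  shows "(\<integral>x. F x \<partial>lebesgue_on T) = (\<integral>x. F x \<partial>lebesgue_on S)"
  using assms by (intro integral_lebesgue_on_subset) auto

text \<open>A test function on the smaller set is one on the larger set and vanishes with its
  gradient outside the smaller one, so both integrals keep their values.\<close>

lemma has_weak_curl_subset:
  assumes "has_weak_curl T u c" "open S" "open T" "S \<subseteq> T"
  shows "has_weak_curl S u c"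
  unfolding has_weak_curl_def
proof (intro conjI ballI)
  show "c \<in> L2 S" using assms by (auto simp: has_weak_curl_def intro: L2_subset)
  fix \<psi> assume \<psi>: "\<psi> \<in> test_functions S"
  then have "(\<integral>x. \<psi> x *\<^sub>R c x \<partial>lebesgue_on T) = (\<integral>x. cross3 (u x) (grad \<psi> x) \<partial>lebesgue_on T)"
    using assms(1) test_functions_mono[OF assms(4)] unfolding has_weak_curl_def by blast
  moreover have "(\<integral>x. \<psi> x *\<^sub>R c x \<partial>lebesgue_on T) = (\<integral>x. \<psi> x *\<^sub>R c x \<partial>lebesgue_on S)"
    using test_function_eq_0[OF \<psi>] by (intro integral_test_subset assms) simp
  moreover have "(\<integral>x. cross3 (u x) (grad \<psi> x) \<partial>lebesgue_on T) = (\<integral>x. cross3 (u x) (grad \<psi> x) \<partial>lebesgue_on S)"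
    using test_function_grad_eq_0[OF \<psi>] by (intro integral_test_subset assms) simp
  ultimately show "(\<integral>x. \<psi> x *\<^sub>R c x \<partial>lebesgue_on S) = (\<integral>x. cross3 (u x) (grad \<psi> x) \<partial>lebesgue_on S)"
    by simp
qed

lemma has_weak_div_subset:
  assumes "has_weak_div T u d" "open S" "open T" "S \<subseteq> T"
  shows "has_weak_div S u d"
  unfolding has_weak_div_def
proof (intro conjI ballI)
  show "d \<in> L2 S" using assms by (auto simp: has_weak_div_def intro: L2_subset)
  fix \<psi> assume \<psi>: "\<psi> \<in> test_functions S"
  then have "(\<integral>x. \<psi> x * d x \<partial>lebesgue_on T) = - (\<integral>x. u x \<bullet> grad \<psi> x \<partial>lebesgue_on T)"
    using assms(1) test_functions_mono[OF assms(4)] unfolding has_weak_div_def by blast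
  moreover have "(\<integral>x. \<psi> x * d x \<partial>lebesgue_on T) = (\<integral>x. \<psi> x * d x \<partial>lebesgue_on S)"
    using test_function_eq_0[OF \<psi>] by (intro integral_test_subset assms) simp
  moreover have "(\<integral>x. u x \<bullet> grad \<psi> x \<partial>lebesgue_on T) = (\<integral>x. u x \<bullet> grad \<psi> x \<partial>lebesgue_on S)"
    using test_function_grad_eq_0[OF \<psi>] by (intro integral_test_subset assms) simp
  ultimately show "(\<integral>x. \<psi> x * d x \<partial>lebesgue_on S) = - (\<integral>x. u x \<bullet> grad \<psi> x \<partial>lebesgue_on S)"
    by simp
qed

lemma has_weak_div_cong_AE:
  assumes "S \<in> sets lebesgue" "AE x in lebesgue_on S. u x = v x" "has_weak_div S u d"
  shows "has_weak_div S v d"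
proof -
  have "(\<integral>x. u x \<bullet> grad \<psi> x \<partial>lebesgue_on S) = (\<integral>x. v x \<bullet> grad \<psi> x \<partial>lebesgue_on S)" for \<psi>
    by (rule integral_lebesgue_on_cong_AE[OF assms(1)], rule eventually_mono[OF assms(2)]) simp
  with assms(3) show ?thesis by (simp add: has_weak_div_def)
qed

text \<open>Serves to exchange, in (b), the prescribed initial field for the value
  \<open>Dh t0\<close> of the curve, which agrees with it only almost everywhere.\<close>

lemma bdry_div_cong_AE:
  assumes "AE x in lebesgue_on (interior K). u x = v x" "has_weak_div (interior K) u d"
  shows "bdry_div K f u = bdry_div K f v"
proof -
  have S: "interior K \<in> sets lebesgue" by simp
  have "AE x in lebesgue_on (interior K). weak_div (interior K) u x = d x"
    "AE x in lebesgue_on (interior K). weak_div (interior K) v x = d x"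
    using weak_div_AE[OF open_interior assms(2)]
      weak_div_AE[OF open_interior has_weak_div_cong_AE[OF S assms]] by this+
  with assms(1) have "AE x in lebesgue_on (interior K).
      weak_grad (interior K) f x \<bullet> u x + f x * weak_div (interior K) u x
      = weak_grad (interior K) f x \<bullet> v x + f x * weak_div (interior K) v x"
    by eventually_elim simp
  then show ?thesis
    unfolding bdry_div_def by (rule integral_lebesgue_on_cong_AE[OF S])
qed

lemma has_weak_div_diff:
  assumes "open S" "u \<in> L2 S" "v \<in> L2 S" "has_weak_div S u d" "has_weak_div S v e"
  shows "has_weak_div S (\<lambda>x. u x - v x) (\<lambda>x. d x - e x)"
  unfolding has_weak_div_def
proof (intro conjI ballI)
  have L2: "d \<in> L2 S" "e \<in> L2 S" using assms by (auto simp: has_weak_div_def)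
  then show "(\<lambda>x. d x - e x) \<in> L2 S" by (rule L2_diff)
  fix \<psi> assume \<psi>: "\<psi> \<in> test_functions S"
  have \<psi>2: "\<psi> \<in> L2 S" "grad \<psi> \<in> L2 S"
    using \<psi> assms(1) by (auto intro: test_function_L2 test_function_grad_L2)
  have "(\<integral>x. \<psi> x * d x \<partial>lebesgue_on S) = - (\<integral>x. u x \<bullet> grad \<psi> x \<partial>lebesgue_on S)"
    "(\<integral>x. \<psi> x * e x \<partial>lebesgue_on S) = - (\<integral>x. v x \<bullet> grad \<psi> x \<partial>lebesgue_on S)"
    using assms(4,5) \<psi> by (auto simp: has_weak_div_def)
  then show "(\<integral>x. \<psi> x * (d x - e x) \<partial>lebesgue_on S) = - (\<integral>x. (u x - v x) \<bullet> grad \<psi> x \<partial>lebesgue_on S)"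
    using integrable_L2_inner[OF \<psi>2(1) L2(1)] integrable_L2_inner[OF \<psi>2(1) L2(2)]
      integrable_L2_inner[OF assms(2) \<psi>2(2)] integrable_L2_inner[OF assms(3) \<psi>2(2)]
    by (simp add: right_diff_distrib inner_diff_left)
qed

section \<open>Curl of a gradient and divergence of a curl in weak form\<close>

lemma integrable_vec:
  fixes F :: "'a \<Rightarrow> R3"
  assumes "\<And>i. integrable M (\<lambda>x. F x $ i)"
  shows "integrable M F"
proof -
  have "integrable M (\<lambda>x. \<Sum>i\<in>UNIV. F x $ i *\<^sub>R axis i (1::real))"
    using assms by (intro Bochner_Integration.integrable_sum integrable_scaleR_left)
  moreover have "(\<Sum>i\<in>UNIV. F x $ i *\<^sub>R axis i 1) = F x" for x
    by (metis basis_expansion scalar_mult_eq_scaleR)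
  ultimately show ?thesis by simp
qed

lemma integral_vec_nth:
  fixes F :: "'a \<Rightarrow> R3"
  assumes "integrable M F"
  shows "(\<integral>x. F x \<partial>M) $ i = (\<integral>x. F x $ i \<partial>M)"
  using integral_bounded_linear[OF bounded_linear_vec_nth assms] by simp

lemma cross3_nth:
  "cross3 a b $ 1 = a $ 2 * b $ 3 - a $ 3 * b $ 2"
  "cross3 a b $ 2 = a $ 3 * b $ 1 - a $ 1 * b $ 3"
  "cross3 a b $ 3 = a $ 1 * b $ 2 - a $ 2 * b $ 1"
  by (simp_all add: cross3_def)

lemma integrable_L2_mult:
  "f \<in> L2 S \<Longrightarrow> g \<in> L2 S \<Longrightarrow> integrable (lebesgue_on S) (\<lambda>x. f x * g x :: real)"
  using integrable_L2_inner[of f S g] by simp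

lemma integrable_L2_cross3:
  assumes "f \<in> L2 S" "g \<in> L2 S"
  shows "integrable (lebesgue_on S) (\<lambda>x. cross3 (f x) (g x))"
proof (rule integrable_vec)
  fix i :: 3
  have "integrable (lebesgue_on S) (\<lambda>x. f x $ j * g x $ k)" for j k
    using assms by (intro integrable_L2_mult L2_component)
  then show "integrable (lebesgue_on S) (\<lambda>x. cross3 (f x) (g x) $ i)"
    using exhaust_3[of i] by (auto simp: cross3_nth)
qed

lemma test_function_C_k: "\<psi> \<in> test_functions S \<Longrightarrow> C_k k \<psi>"
  unfolding test_functions_def by blast

text \<open>Testing the weak gradient with the partial derivatives of \<open>\<psi>\<close> moves
  all derivatives to the test function. Each component of the cross product then becomes a
  difference of mixed second derivatives of \<open>\<psi>\<close> integrated against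
  \<open>f\<close>.\<close>

lemma has_weak_curl_grad:
  assumes "open S" "f \<in> L2 S" "has_weak_grad S f g"
  shows "has_weak_curl S g (\<lambda>x. 0)"
  unfolding has_weak_curl_def
proof (intro conjI ballI L2_0)
  fix \<psi> assume \<psi>: "\<psi> \<in> test_functions S"
  have S: "S \<in> sets lebesgue" using assms(1) by simp
  have g: "g \<in> L2 S" using assms(3) by (simp add: has_weak_grad_def)
  have grad\<psi>: "grad \<psi> \<in> L2 S" using \<psi> S by (rule test_function_grad_L2)
  have int: "integrable (lebesgue_on S) (\<lambda>x. g x $ i * grad \<psi> x $ j)" for i j
    by (intro integrable_L2_mult L2_component g grad\<psi>)
  have eq: "(\<integral>x. g x $ i * grad \<psi> x $ j \<partial>lebesgue_on S)
      = - (\<integral>x. f x * grad (\<lambda>y. grad \<psi> y $ j) x $ i \<partial>lebesgue_on S)" for i j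
  proof -
    let ?\<psi>j = "\<lambda>y. grad \<psi> y $ j"
    have t: "?\<psi>j \<in> test_functions S" using \<psi> by (rule test_function_grad)
    have i1: "integrable (lebesgue_on S) (\<lambda>x. ?\<psi>j x *\<^sub>R g x)"
      using test_function_L2[OF t S] g by (rule integrable_L2_scaleR)
    have i2: "integrable (lebesgue_on S) (\<lambda>x. f x *\<^sub>R grad ?\<psi>j x)"
      using assms(2) test_function_grad_L2[OF t S] by (rule integrable_L2_scaleR)
    have "(\<integral>x. ?\<psi>j x *\<^sub>R g x \<partial>lebesgue_on S) $ i = (- (\<integral>x. f x *\<^sub>R grad ?\<psi>j x \<partial>lebesgue_on S)) $ i"
      using assms(3) t by (simp add: has_weak_grad_def)
    then show ?thesis
      by (simp add: integral_vec_nth[OF i1] integral_vec_nth[OF i2] mult.commute)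
  qed
  have sym: "(\<integral>x. g x $ i * grad \<psi> x $ j \<partial>lebesgue_on S) = (\<integral>x. g x $ j * grad \<psi> x $ i \<partial>lebesgue_on S)" for i j
    unfolding eq using mixed_partials_commute[OF test_function_C_k[OF \<psi>]] by simp
  have "(\<integral>x. cross3 (g x) (grad \<psi> x) \<partial>lebesgue_on S) $ i = 0" for i
    unfolding integral_vec_nth[OF integrable_L2_cross3[OF g grad\<psi>]]
    using exhaust_3[of i] int sym[of 2 3] sym[of 3 1] sym[of 1 2] by (auto simp: cross3_nth)
  then show "(\<integral>x. \<psi> x *\<^sub>R 0 \<partial>lebesgue_on S) = (\<integral>x. cross3 (g x) (grad \<psi> x) \<partial>lebesgue_on S)"
    by (simp add: vec_eq_iff)
qed

text \<open>The weak curl is tested with each partial derivative \<open>?d i\<close>, keeping the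
  \<open>i\<close>-th component. In the sum over \<open>i\<close>, the antisymmetric cross product
  meets the symmetric Hessian of \<open>\<psi>\<close>, so the integrand is zero at every
  point.\<close>

lemma weak_curl_div_free:
  assumes "open S" "u \<in> L2 S" "has_weak_curl S u c" "\<psi> \<in> test_functions S"
  shows "(\<integral>x. grad \<psi> x \<bullet> c x \<partial>lebesgue_on S) = 0"
proof -
  have S: "S \<in> sets lebesgue" using assms(1) by simp
  have c: "c \<in> L2 S" using assms(3) by (simp add: has_weak_curl_def)
  let ?d = "\<lambda>i y. grad \<psi> y $ i"
  have t: "?d i \<in> test_functions S" for i using assms(4) by (rule test_function_grad)
  have int: "integrable (lebesgue_on S) (\<lambda>x. ?d i x *\<^sub>R c x)" for i
    using test_function_L2[OF t S] c by (rule integrable_L2_scaleR)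
  have intc: "integrable (lebesgue_on S) (\<lambda>x. cross3 (u x) (grad (?d i) x))" for i
    using assms(2) test_function_grad_L2[OF t S] by (rule integrable_L2_cross3)
  have intn: "integrable (lebesgue_on S) (\<lambda>x. F x $ i)"
    if "integrable (lebesgue_on S) F" for F :: "R3 \<Rightarrow> R3" and i
    using integrable_bounded_linear[OF bounded_linear_vec_nth that] .
  have "(\<integral>x. grad \<psi> x \<bullet> c x \<partial>lebesgue_on S) = (\<integral>x. (\<Sum>i\<in>UNIV. (?d i x *\<^sub>R c x) $ i) \<partial>lebesgue_on S)"
    by (simp add: inner_vec_def)
  also have "\<dots> = (\<Sum>i\<in>UNIV. (\<integral>x. ?d i x *\<^sub>R c x \<partial>lebesgue_on S) $ i)"
    by (subst Bochner_Integration.integral_sum) (simp_all only: intn int integral_vec_nth[OF int])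
  also have "\<dots> = (\<Sum>i\<in>UNIV. (\<integral>x. cross3 (u x) (grad (?d i) x) \<partial>lebesgue_on S) $ i)"
    using assms(3) t by (simp add: has_weak_curl_def)
  also have "\<dots> = (\<integral>x. (\<Sum>i\<in>UNIV. cross3 (u x) (grad (?d i) x) $ i) \<partial>lebesgue_on S)"
    by (subst Bochner_Integration.integral_sum) (simp_all only: intn intc integral_vec_nth[OF intc])
  also have "\<dots> = (\<integral>x. 0 \<partial>lebesgue_on S)"
  proof (rule Bochner_Integration.integral_cong[OF refl])
    fix x
    have sym: "grad (?d i) x $ j = grad (?d j) x $ i" for i j
      using mixed_partials_commute[OF test_function_C_k[OF assms(4)]] .
    show "(\<Sum>i\<in>UNIV. cross3 (u x) (grad (?d i) x) $ i) = 0"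
      using sym[of 1 2] sym[of 1 3] sym[of 2 3] by (simp add: sum_3 cross3_nth)
  qed
  finally show ?thesis by simp
qed

section \<open>Curves of square integrable functions\<close>

lemma dt_L2:
  assumes "C1_curve (L2 \<Omega>) (L2_norm \<Omega>) I u" "t \<in> I"
  shows "dt \<Omega> I u t \<in> L2 \<Omega>" "has_curve_deriv (L2_norm \<Omega>) I u (dt \<Omega> I u t) t"
proof -
  have "\<exists>v. v \<in> L2 \<Omega> \<and> has_curve_deriv (L2_norm \<Omega>) I u v t"
    using assms unfolding C1_curve_def C0_curve_def by blast
  then have "dt \<Omega> I u t \<in> L2 \<Omega> \<and> has_curve_deriv (L2_norm \<Omega>) I u (dt \<Omega> I u t) t"
    unfolding dt_def by (rule someI_ex)
  then show "dt \<Omega> I u t \<in> L2 \<Omega>" "has_curve_deriv (L2_norm \<Omega>) I u (dt \<Omega> I u t) t"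
    by auto
qed

lemma C1_curve_mem: "C1_curve X N I u \<Longrightarrow> t \<in> I \<Longrightarrow> u t \<in> X"
  by (simp add: C1_curve_def)

lemma eventually_at_within_mem: "\<forall>\<^sub>F s in at t within I. s \<in> I \<and> s \<noteq> t"
  by (simp add: eventually_at_filter)

text \<open>The increment is \<open>s - t\<close> times the difference quotient, which stays bounded
  in norm near \<open>t\<close> because it converges to \<open>?v\<close>.\<close>

lemma C1_curve_imp_C0_curve_L2:
  assumes u: "C1_curve (L2 \<Omega>) (L2_norm \<Omega>) I u"
  shows "C0_curve (L2 \<Omega>) (L2_norm \<Omega>) I u"
  unfolding C0_curve_def
proof (intro conjI ballI)
  fix t assume t: "t \<in> I"
  show "u t \<in> L2 \<Omega>" using u t by (rule C1_curve_mem)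
  let ?v = "dt \<Omega> I u t"
  let ?r = "\<lambda>s. L2_norm \<Omega> (\<lambda>x. (u s x - u t x) /\<^sub>R (s - t) - ?v x)"
  have "((\<lambda>s. \<bar>s - t\<bar> * (?r s + L2_norm \<Omega> ?v)) \<longlongrightarrow> \<bar>t - t\<bar> * (0 + L2_norm \<Omega> ?v)) (at t within I)"
    using dt_L2(2)[OF u t] unfolding has_curve_deriv_def by (intro tendsto_intros)
  then have lim: "((\<lambda>s. \<bar>s - t\<bar> * (?r s + L2_norm \<Omega> ?v)) \<longlongrightarrow> 0) (at t within I)" by simp
  show "((\<lambda>s. L2_norm \<Omega> (\<lambda>x. u s x - u t x)) \<longlongrightarrow> 0) (at t within I)"
  proof (rule tendsto_sandwich[OF _ _ tendsto_const lim])
    show "\<forall>\<^sub>F s in at t within I. L2_norm \<Omega> (\<lambda>x. u s x - u t x) \<le> \<bar>s - t\<bar> * (?r s + L2_norm \<Omega> ?v)"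
      using eventually_at_within_mem
    proof eventually_elim
      case (elim s)
      let ?q = "\<lambda>x. (u s x - u t x) /\<^sub>R (s - t) - ?v x"
      have "?q \<in> L2 \<Omega>"
        using elim t dt_L2(1)[OF u t] C1_curve_mem[OF u] by (intro L2_diff L2_scaleR) auto
      then have "L2_norm \<Omega> (\<lambda>x. ?q x + ?v x) \<le> ?r s + L2_norm \<Omega> ?v"
        using dt_L2(1)[OF u t] by (rule L2_norm_triangle)
      then have "\<bar>s - t\<bar> * L2_norm \<Omega> (\<lambda>x. ?q x + ?v x) \<le> \<bar>s - t\<bar> * (?r s + L2_norm \<Omega> ?v)"
        by (intro mult_left_mono) auto
      then show ?case
        using elim unfolding L2_norm_scaleR[symmetric] by simp
    qed
  qed (simp add: L2_norm_nonneg)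
qed

text \<open>Pairing with a fixed \<open>w\<close> is bounded by Cauchy-Schwarz, so norm limits of
  difference quotients pass through it. Integrating over a subset \<open>S\<close> lets the
  derivative taken on \<Omega> serve for a single element.\<close>

lemma has_real_derivative_L2_inner:
  fixes u :: "real \<Rightarrow> R3 \<Rightarrow> 'b::euclidean_space"
  assumes u: "C1_curve (L2 \<Omega>) (L2_norm \<Omega>) I u" and t: "t \<in> I"
    and S: "S \<in> sets lebesgue" "\<Omega> \<in> sets lebesgue" "S \<subseteq> \<Omega>" and w: "w \<in> L2 S"
  shows "((\<lambda>s. \<integral>x. w x \<bullet> u s x \<partial>lebesgue_on S) has_real_derivative
    (\<integral>x. w x \<bullet> dt \<Omega> I u t x \<partial>lebesgue_on S)) (at t within I)"
  unfolding has_field_derivative_iff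
proof (rule LIM_zero_cancel)
  let ?v = "dt \<Omega> I u t"
  let ?F = "\<lambda>f. \<integral>x. w x \<bullet> f x \<partial>lebesgue_on S"
  let ?r = "\<lambda>s. L2_norm \<Omega> (\<lambda>x. (u s x - u t x) /\<^sub>R (s - t) - ?v x)"
  have "((\<lambda>s. L2_norm S w * ?r s) \<longlongrightarrow> L2_norm S w * 0) (at t within I)"
    using dt_L2(2)[OF u t] unfolding has_curve_deriv_def by (intro tendsto_intros)
  then have lim: "((\<lambda>s. L2_norm S w * ?r s) \<longlongrightarrow> 0) (at t within I)" by simp
  show "((\<lambda>s. (?F (u s) - ?F (u t)) / (s - t) - ?F ?v) \<longlongrightarrow> 0) (at t within I)"
  proof (rule Lim_null_comparison[OF _ lim])
    show "\<forall>\<^sub>F s in at t within I. norm ((?F (u s) - ?F (u t)) / (s - t) - ?F ?v) \<le> L2_norm S w * ?r s"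
      using eventually_at_within_mem
    proof eventually_elim
      case (elim s)
      let ?q = "\<lambda>x. (u s x - u t x) /\<^sub>R (s - t) - ?v x"
      have L2: "u s \<in> L2 S" "u t \<in> L2 S" "?v \<in> L2 S" "?q \<in> L2 \<Omega>"
        using elim t dt_L2(1)[OF u t] C1_curve_mem[OF u] S
        by (auto intro!: L2_diff L2_scaleR intro: L2_subset)
      have "?F ?q = (?F (u s) - ?F (u t)) / (s - t) - ?F ?v"
        using integrable_L2_inner[OF w L2(1)] integrable_L2_inner[OF w L2(2)] integrable_L2_inner[OF w L2(3)]
        by (simp add: inner_diff_right divide_inverse mult.commute)
      moreover have "\<bar>?F ?q\<bar> \<le> L2_norm S w * L2_norm S ?q"
        using w L2_subset[OF L2(4) S] by (rule L2_Cauchy_Schwarz)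
      moreover have "L2_norm S w * L2_norm S ?q \<le> L2_norm S w * ?r s"
        using L2_norm_subset[OF L2(4) S] by (intro mult_left_mono L2_norm_nonneg)
      ultimately show ?case by simp
    qed
  qed
qed

lemma constant_on_interval:
  fixes F :: "real \<Rightarrow> real"
  assumes "is_interval I" "\<And>t. t \<in> I \<Longrightarrow> (F has_real_derivative 0) (at t within I)" "s \<in> I" "t \<in> I"
  shows "F s = F t"
  using has_field_derivative_zero_constant[of I F] assms is_interval_convex by metis

section \<open>Propagation of the divergence constraint\<close>

text \<open>\<open>Dh t0\<close> need not satisfy Gauss' law, so the candidate divergence keeps the
  initial one, \<open>d0\<close>, and adds only the increment of the charge.\<close>

lemma has_weak_div_evolution:
  assumes \<Omega>: "open \<Omega>" and I: "is_interval I" "t0 \<in> I" "t \<in> I"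
    and src: "sources \<Omega> I J \<rho>" and Hh: "\<And>t. t \<in> I \<Longrightarrow> Hh t \<in> Hcurl \<Omega>"
    and evol: "Dh_evolution \<Omega> I J Hh Dh"
    and div0: "has_weak_div \<Omega> (Dh t0) d0"
  shows "has_weak_div \<Omega> (Dh t) (\<lambda>x. d0 x + (\<rho> t x - \<rho> t0 x))"
  unfolding has_weak_div_def
proof (intro conjI ballI)
  have sets: "\<Omega> \<in> sets lebesgue" using \<Omega> by simp
  have Dh: "C1_curve (L2 \<Omega>) (L2_norm \<Omega>) I Dh"
    and ode: "\<And>t. t \<in> I \<Longrightarrow> AE x in lebesgue_on \<Omega>. dt \<Omega> I Dh t x + J t x = weak_curl \<Omega> (Hh t) x"
    using evol by (auto simp: Dh_evolution_def)
  have \<rho>: "C1_curve (L2 \<Omega>) (L2_norm \<Omega>) I \<rho>" and J: "\<And>t. t \<in> I \<Longrightarrow> J t \<in> Hdiv \<Omega>"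
    and charge: "\<And>t. t \<in> I \<Longrightarrow> AE x in lebesgue_on \<Omega>. dt \<Omega> I \<rho> t x + weak_div \<Omega> (J t) x = 0"
    using src by (auto simp: sources_def C0_curve_def)
  note \<rho>_mem = C1_curve_mem[OF \<rho>] and Dh_mem = C1_curve_mem[OF Dh]
  have d0: "d0 \<in> L2 \<Omega>" using div0 by (simp add: has_weak_div_def)
  then show "(\<lambda>x. d0 x + (\<rho> t x - \<rho> t0 x)) \<in> L2 \<Omega>"
    using \<rho>_mem I by (intro L2_add L2_diff) auto
  fix \<psi> assume \<psi>: "\<psi> \<in> test_functions \<Omega>"
  have \<psi>2: "\<psi> \<in> L2 \<Omega>" "grad \<psi> \<in> L2 \<Omega>"
    using \<psi> sets by (auto intro: test_function_L2 test_function_grad_L2)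
  \<comment> \<open>\<open>F\<close> is the weak form of \<open>\<rho> - div Dh\<close>, tested with
    \<open>\<psi>\<close>. In its derivative the curl is orthogonal to \<open>grad \<psi>\<close>,
    and \<open>- J\<close> contributes \<open>div J\<close>, which charge conservation
    cancels.\<close>
  define F where "F s = (\<integral>x. grad \<psi> x \<bullet> Dh s x \<partial>lebesgue_on \<Omega>) + (\<integral>x. \<psi> x \<bullet> \<rho> s x \<partial>lebesgue_on \<Omega>)" for s
  have "(F has_real_derivative 0) (at s within I)" if s: "s \<in> I" for s
  proof -
    have J2: "J s \<in> L2 \<Omega>" "weak_div \<Omega> (J s) \<in> L2 \<Omega>" "has_weak_div \<Omega> (J s) (weak_div \<Omega> (J s))"
      using J[OF s] has_weak_div_weak_div[OF J[OF s]] by (auto simp: Hdiv_def has_weak_div_def)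
    have H2: "Hh s \<in> L2 \<Omega>" "weak_curl \<Omega> (Hh s) \<in> L2 \<Omega>" "has_weak_curl \<Omega> (Hh s) (weak_curl \<Omega> (Hh s))"
      using Hh[OF s] has_weak_curl_weak_curl[OF Hh[OF s]] by (auto simp: Hcurl_def has_weak_curl_def)
    have "(\<integral>x. grad \<psi> x \<bullet> dt \<Omega> I Dh s x \<partial>lebesgue_on \<Omega>)
        = (\<integral>x. grad \<psi> x \<bullet> weak_curl \<Omega> (Hh s) x - grad \<psi> x \<bullet> J s x \<partial>lebesgue_on \<Omega>)"
    proof (rule integral_lebesgue_on_cong_AE[OF sets])
      show "AE x in lebesgue_on \<Omega>. grad \<psi> x \<bullet> dt \<Omega> I Dh s x
          = grad \<psi> x \<bullet> weak_curl \<Omega> (Hh s) x - grad \<psi> x \<bullet> J s x"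
        using ode[OF s] by eventually_elim (simp add: inner_diff_right[symmetric] add_diff_eq[symmetric] flip: eq_diff_eq)
    qed
    also have "\<dots> = - (\<integral>x. J s x \<bullet> grad \<psi> x \<partial>lebesgue_on \<Omega>)"
      using weak_curl_div_free[OF \<Omega> H2(1,3) \<psi>] integrable_L2_inner[OF \<psi>2(2) H2(2)]
        integrable_L2_inner[OF \<psi>2(2) J2(1)] by (simp add: inner_commute)
    also have "\<dots> = (\<integral>x. \<psi> x * weak_div \<Omega> (J s) x \<partial>lebesgue_on \<Omega>)"
      using J2(3) \<psi> by (simp add: has_weak_div_def)
    also have "\<dots> = (\<integral>x. - (\<psi> x \<bullet> dt \<Omega> I \<rho> s x) \<partial>lebesgue_on \<Omega>)"
    proof (rule integral_lebesgue_on_cong_AE[OF sets])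
      show "AE x in lebesgue_on \<Omega>. \<psi> x * weak_div \<Omega> (J s) x = - (\<psi> x \<bullet> dt \<Omega> I \<rho> s x)"
        using charge[OF s] by eventually_elim (simp add: add_eq_0_iff)
    qed
    finally have "(\<integral>x. grad \<psi> x \<bullet> dt \<Omega> I Dh s x \<partial>lebesgue_on \<Omega>) + (\<integral>x. \<psi> x \<bullet> dt \<Omega> I \<rho> s x \<partial>lebesgue_on \<Omega>) = 0"
      by simp
    then show ?thesis
      using DERIV_add[OF has_real_derivative_L2_inner[OF Dh s sets sets order_refl \<psi>2(2)]
        has_real_derivative_L2_inner[OF \<rho> s sets sets order_refl \<psi>2(1)]]
      by (simp add: F_def[abs_def])
  qed
  then have "F t = F t0" using I by (intro constant_on_interval)
  moreover have "(\<integral>x. \<psi> x * d0 x \<partial>lebesgue_on \<Omega>) = - (\<integral>x. Dh t0 x \<bullet> grad \<psi> x \<partial>lebesgue_on \<Omega>)"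
    using div0 \<psi> by (simp add: has_weak_div_def)
  ultimately show "(\<integral>x. \<psi> x * (d0 x + (\<rho> t x - \<rho> t0 x)) \<partial>lebesgue_on \<Omega>) = - (\<integral>x. Dh t x \<bullet> grad \<psi> x \<partial>lebesgue_on \<Omega>)"
    using integrable_L2_mult[OF \<psi>2(1) d0] integrable_L2_mult[OF \<psi>2(1) \<rho>_mem[OF I(3)]]
      integrable_L2_mult[OF \<psi>2(1) \<rho>_mem[OF I(2)]]
    by (simp add: F_def distrib_left right_diff_distrib inner_commute)
qed

text \<open>A gradient is curl free, so it makes the magnetic term of equation (a) disappear.\<close>

lemma eq_a_grad:
  assumes "eq_a \<T> D' J H Hh" "K \<in> \<T>" and S: "S = interior K" and f: "f \<in> H1 S"
    and L2: "D' \<in> L2 S" "J \<in> L2 S" "Hh \<in> Hcurl S"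
  shows "(\<integral>x. weak_grad S f x \<bullet> D' x \<partial>lebesgue_on S)
    = (\<integral>x. weak_grad S f x \<bullet> (weak_curl S Hh x - J x) \<partial>lebesgue_on S)"
proof -
  let ?g = "weak_grad S f"
  have S': "open S" "S \<in> sets lebesgue" by (auto simp: S)
  have g: "has_weak_grad S f ?g" "?g \<in> L2 S"
    using has_weak_grad_weak_grad[OF f] by (auto simp: has_weak_grad_def)
  have "f \<in> L2 S" using f by (simp add: H1_def)
  with g S' have curl: "has_weak_curl S ?g (\<lambda>x. 0)" by (intro has_weak_curl_grad)
  have curl0: "AE x in lebesgue_on S. weak_curl S ?g x = 0"
    using weak_curl_AE[OF S'(1) curl] .
  have c: "weak_curl S Hh \<in> L2 S"
    using has_weak_curl_weak_curl[OF L2(3)] by (simp add: has_weak_curl_def)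
  have "?g \<in> Hcurl S" using g curl by (auto simp: Hcurl_def)
  then have "(\<integral>x. ?g x \<bullet> (D' x + J x) - weak_curl S ?g x \<bullet> H x \<partial>lebesgue_on S)
      + (\<integral>x. weak_curl S ?g x \<bullet> Hh x - ?g x \<bullet> weak_curl S Hh x \<partial>lebesgue_on S) = 0"
    using assms(1,2) by (auto simp: eq_a_def bdry_curl_def S)
  moreover have "(\<integral>x. ?g x \<bullet> (D' x + J x) - weak_curl S ?g x \<bullet> H x \<partial>lebesgue_on S)
      = (\<integral>x. ?g x \<bullet> D' x + ?g x \<bullet> J x \<partial>lebesgue_on S)"
    by (rule integral_lebesgue_on_cong_AE[OF S'(2)], rule eventually_mono[OF curl0])
      (simp add: inner_add_right)
  \<comment> \<open>The curl of the test field also drops out of the boundary term. The other half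
    of that term brings in the curl of \<open>Hh\<close>, which is how the right-hand side of the
    evolution equation enters.\<close>
  moreover have "(\<integral>x. weak_curl S ?g x \<bullet> Hh x - ?g x \<bullet> weak_curl S Hh x \<partial>lebesgue_on S)
      = (\<integral>x. - (?g x \<bullet> weak_curl S Hh x) \<partial>lebesgue_on S)"
    by (rule integral_lebesgue_on_cong_AE[OF S'(2)], rule eventually_mono[OF curl0]) simp
  ultimately show ?thesis
    using integrable_L2_inner[OF g(2) L2(1)] integrable_L2_inner[OF g(2) L2(2)]
      integrable_L2_inner[OF g(2) c] by (simp add: inner_diff_right)
qed

text \<open>\<open>bdry_div\<close> is itself a volume integral, so (b) splits into a gradient
  pairing and a charge mismatch. Any weak divergence \<open>d\<close> is allowed, so that the one
  computed for \<open>Dh\<close> on \<Omega> can be inserted.\<close>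

lemma eq_b_integral:
  assumes S: "S = interior K" and f: "f \<in> H1 S" and L2: "D \<in> L2 S" "r \<in> L2 S" "Dh \<in> L2 S"
    and d: "has_weak_div S Dh d"
  shows "(\<integral>x. weak_grad (interior K) f x \<bullet> D x + f x * r x \<partial>lebesgue_on (interior K)) - bdry_div K f Dh
    = (\<integral>x. weak_grad S f x \<bullet> D x \<partial>lebesgue_on S) - (\<integral>x. weak_grad S f x \<bullet> Dh x \<partial>lebesgue_on S)
      + (\<integral>x. f x * (r x - d x) \<partial>lebesgue_on S)"
proof -
  let ?g = "weak_grad S f"
  have S': "open S" "S \<in> sets lebesgue" by (auto simp: S)
  have g: "?g \<in> L2 S" using has_weak_grad_weak_grad[OF f] by (auto simp: has_weak_grad_def)
  have f2: "f \<in> L2 S" using f by (simp add: H1_def)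
  have d2: "d \<in> L2 S" using d by (simp add: has_weak_div_def)
  have "bdry_div K f Dh = (\<integral>x. ?g x \<bullet> Dh x + f x * d x \<partial>lebesgue_on S)"
    unfolding bdry_div_def S[symmetric]
    by (rule integral_lebesgue_on_cong_AE[OF S'(2)], rule eventually_mono[OF weak_div_AE[OF S'(1) d]]) simp
  then show ?thesis
    using integrable_L2_inner[OF g L2(1)] integrable_L2_inner[OF g L2(3)]
      integrable_L2_mult[OF f2 L2(2)] integrable_L2_mult[OF f2 d2]
    by (simp add: S[symmetric] right_diff_distrib)
qed

text \<open>Paired with a weak gradient on one element, \<open>D\<close> and \<open>Dh\<close> have
  the same time derivative, although the derivatives themselves may differ as fields. What remains
  of (b) is constant in time and is zero at \<open>t0\<close>.\<close>

lemma eq_b_propagates: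
  assumes \<Omega>: "open \<Omega>" and mesh: "\<And>K. K \<in> \<T> \<Longrightarrow> interior K \<subseteq> \<Omega>"
    and I: "is_interval I" "t0 \<in> I" "t \<in> I"
    and src: "sources \<Omega> I J \<rho>" and Hh: "\<And>t. t \<in> I \<Longrightarrow> Hh t \<in> Hcurl \<Omega>"
    and evol: "Dh_evolution \<Omega> I J Hh Dh" and D: "C1_curve (L2 \<Omega>) (L2_norm \<Omega>) I D"
    and a: "\<And>t. t \<in> I \<Longrightarrow> eq_a \<T> (dt \<Omega> I D t) (J t) (H t) (Hh t)"
    and Dh0: "Dh t0 \<in> Hdiv \<Omega>" and b: "eq_b \<T> (D t0) (\<rho> t0) (Dh t0)"
  shows "eq_b \<T> (D t) (\<rho> t) (Dh t)"
  unfolding eq_b_def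
proof (intro ballI)
  fix K f assume K: "K \<in> \<T>" and "f \<in> H1 (interior K)"
  define S where "S = interior K"
  have f: "f \<in> H1 S" using \<open>f \<in> H1 (interior K)\<close> by (simp add: S_def)
  have S: "open S" "S \<in> sets lebesgue" "\<Omega> \<in> sets lebesgue" "S \<subseteq> \<Omega>"
    using \<Omega> mesh[OF K] by (auto simp: S_def)
  have sub3: "u \<in> L2 S" if "u \<in> L2 \<Omega>" for u :: "R3 \<Rightarrow> R3"
    using that S(2-4) by (rule L2_subset)
  have sub1: "u \<in> L2 S" if "u \<in> L2 \<Omega>" for u :: "R3 \<Rightarrow> real"
    using that S(2-4) by (rule L2_subset)
  let ?g = "weak_grad S f"
  have g: "?g \<in> L2 S" using has_weak_grad_weak_grad[OF f] by (auto simp: has_weak_grad_def)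
  have Dh: "C1_curve (L2 \<Omega>) (L2_norm \<Omega>) I Dh"
    and ode: "\<And>t. t \<in> I \<Longrightarrow> AE x in lebesgue_on \<Omega>. dt \<Omega> I Dh t x + J t x = weak_curl \<Omega> (Hh t) x"
    using evol by (auto simp: Dh_evolution_def)
  have \<rho>: "C1_curve (L2 \<Omega>) (L2_norm \<Omega>) I \<rho>" and J: "\<And>t. t \<in> I \<Longrightarrow> J t \<in> Hdiv \<Omega>"
    using src by (auto simp: sources_def C0_curve_def)
  let ?d0 = "weak_div \<Omega> (Dh t0)"
  have div0: "has_weak_div \<Omega> (Dh t0) ?d0" using Dh0 by (rule has_weak_div_weak_div)
  define G where "G s = (\<integral>x. ?g x \<bullet> D s x \<partial>lebesgue_on S) - (\<integral>x. ?g x \<bullet> Dh s x \<partial>lebesgue_on S)" for s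
  have "(G has_real_derivative 0) (at s within I)" if s: "s \<in> I" for s
  proof -
    have "J s \<in> L2 \<Omega>" "Hh s \<in> L2 \<Omega>"
      using J[OF s] Hh[OF s] by (auto simp: Hdiv_def Hcurl_def)
    note J2 = this[THEN sub3]
    \<comment> \<open>Equation (a) sees the curl of \<open>Hh\<close> on \<open>S\<close>, the
      evolution equation its curl on \<Omega>; restriction identifies the two almost everywhere on
      \<open>S\<close>.\<close>
    have curl: "has_weak_curl S (Hh s) (weak_curl \<Omega> (Hh s))"
      using has_weak_curl_weak_curl[OF Hh[OF s]] S(1) \<Omega> S(4) by (rule has_weak_curl_subset)
    have Hc: "Hh s \<in> Hcurl S"
      using curl J2(2) by (auto simp: Hcurl_def)
    have "(\<integral>x. ?g x \<bullet> dt \<Omega> I D s x \<partial>lebesgue_on S)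
        = (\<integral>x. ?g x \<bullet> (weak_curl S (Hh s) x - J s x) \<partial>lebesgue_on S)"
      using a[OF s] K S_def f sub3[OF dt_L2(1)[OF D s]] J2(1) Hc by (rule eq_a_grad)
    also have "\<dots> = (\<integral>x. ?g x \<bullet> dt \<Omega> I Dh s x \<partial>lebesgue_on S)"
    proof (rule integral_lebesgue_on_cong_AE[OF S(2)])
      show "AE x in lebesgue_on S. ?g x \<bullet> (weak_curl S (Hh s) x - J s x) = ?g x \<bullet> dt \<Omega> I Dh s x"
        using weak_curl_AE[OF S(1) curl] AE_lebesgue_on_subset[OF S(2-4) ode[OF s]]
        by eventually_elim (metis add_diff_cancel_right')
    qed
    finally show ?thesis
      using DERIV_diff[OF has_real_derivative_L2_inner[OF D s S(2-4) g]
        has_real_derivative_L2_inner[OF Dh s S(2-4) g]]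
      by (simp add: G_def[abs_def])
  qed
  then have "G t = G t0" using I by (intro constant_on_interval)
  moreover have div: "has_weak_div S (Dh s) (\<lambda>x. ?d0 x + (\<rho> s x - \<rho> t0 x))" if "s \<in> I" for s
    using has_weak_div_evolution[OF \<Omega> I(1,2) that src Hh evol div0] S(1) \<Omega> S(4)
    by (rule has_weak_div_subset)
  \<comment> \<open>The charge \<open>\<rho> s\<close> cancels against the same term in the
    divergence of \<open>Dh s\<close>, so the last integral does not depend on
    \<open>s\<close>.\<close>
  have lhs: "(\<integral>x. weak_grad (interior K) f x \<bullet> D s x + f x * \<rho> s x \<partial>lebesgue_on (interior K)) - bdry_div K f (Dh s)
      = G s + (\<integral>x. f x * (\<rho> t0 x - ?d0 x) \<partial>lebesgue_on S)" if "s \<in> I" for s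
    using eq_b_integral[OF S_def f sub3[OF C1_curve_mem[OF D that]] sub1[OF C1_curve_mem[OF \<rho> that]]
      sub3[OF C1_curve_mem[OF Dh that]] div[OF that]]
    by (simp add: G_def algebra_simps)
  moreover have "(\<integral>x. weak_grad (interior K) f x \<bullet> D t0 x + f x * \<rho> t0 x \<partial>lebesgue_on (interior K)) - bdry_div K f (Dh t0) = 0"
    using b K \<open>f \<in> H1 (interior K)\<close> by (simp add: eq_b_def)
  ultimately show "(\<integral>x. weak_grad (interior K) f x \<bullet> D t x + f x * \<rho> t x \<partial>lebesgue_on (interior K)) - bdry_div K f (Dh t) = 0"
    using lhs[OF I(2)] lhs[OF I(3)] by simp
qed

text \<open>The evolution equation controls the curve only in \<open>L2\<close>. In a difference
  \<open>Dh s - Dh t\<close> the initial divergence cancels and \<open>\<rho> s - \<rho> t\<close>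
  is left, so the divergence part of the norm is controlled by the charge.\<close>

lemma C0_curve_Hdiv_evolution:
  assumes \<Omega>: "open \<Omega>" and I: "is_interval I" "t0 \<in> I"
    and src: "sources \<Omega> I J \<rho>" and Hh: "\<And>t. t \<in> I \<Longrightarrow> Hh t \<in> Hcurl \<Omega>"
    and evol: "Dh_evolution \<Omega> I J Hh Dh" and Dh0: "Dh t0 \<in> Hdiv \<Omega>"
  shows "C0_curve (Hdiv \<Omega>) (Hdiv_norm \<Omega>) I Dh"
  unfolding C0_curve_def
proof (intro conjI ballI)
  have Dh: "C1_curve (L2 \<Omega>) (L2_norm \<Omega>) I Dh" using evol by (simp add: Dh_evolution_def)
  have \<rho>: "C1_curve (L2 \<Omega>) (L2_norm \<Omega>) I \<rho>" using src by (simp add: sources_def)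
  note div = has_weak_div_evolution[OF \<Omega> I _ src Hh evol has_weak_div_weak_div[OF Dh0]]
  fix t assume t: "t \<in> I"
  show "Dh t \<in> Hdiv \<Omega>"
    using div[OF t] C1_curve_mem[OF Dh t] by (auto simp: Hdiv_def)
  have eq: "Hdiv_norm \<Omega> (\<lambda>x. Dh s x - Dh t x) =
      sqrt ((L2_norm \<Omega> (\<lambda>x. Dh s x - Dh t x))\<^sup>2 + (L2_norm \<Omega> (\<lambda>x. \<rho> s x - \<rho> t x))\<^sup>2)" if s: "s \<in> I" for s
  proof -
    have "has_weak_div \<Omega> (\<lambda>x. Dh s x - Dh t x) (\<lambda>x. \<rho> s x - \<rho> t x)"
      using has_weak_div_diff[OF \<Omega> C1_curve_mem[OF Dh s] C1_curve_mem[OF Dh t] div[OF s] div[OF t]] by simp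
    then have "L2_norm \<Omega> (weak_div \<Omega> (\<lambda>x. Dh s x - Dh t x)) = L2_norm \<Omega> (\<lambda>x. \<rho> s x - \<rho> t x)"
      using \<Omega> by (intro L2_norm_cong_AE weak_div_AE) auto
    then show ?thesis by (simp add: Hdiv_norm_def)
  qed
  have "((\<lambda>s. sqrt ((L2_norm \<Omega> (\<lambda>x. Dh s x - Dh t x))\<^sup>2 + (L2_norm \<Omega> (\<lambda>x. \<rho> s x - \<rho> t x))\<^sup>2))
      \<longlongrightarrow> sqrt (0\<^sup>2 + 0\<^sup>2)) (at t within I)"
    using C1_curve_imp_C0_curve_L2[OF Dh] C1_curve_imp_C0_curve_L2[OF \<rho>] t
    unfolding C0_curve_def by (intro tendsto_intros) auto
  moreover have "\<forall>\<^sub>F s in at t within I. sqrt ((L2_norm \<Omega> (\<lambda>x. Dh s x - Dh t x))\<^sup>2 + (L2_norm \<Omega> (\<lambda>x. \<rho> s x - \<rho> t x))\<^sup>2)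
      = Hdiv_norm \<Omega> (\<lambda>x. Dh s x - Dh t x)"
    using eventually_at_within_mem by eventually_elim (simp add: eq)
  ultimately show "((\<lambda>s. Hdiv_norm \<Omega> (\<lambda>x. Dh s x - Dh t x)) \<longlongrightarrow> 0) (at t within I)"
    using Lim_transform_eventually by fastforce
qed

section \<open>The vanishing potential\<close>

lemma has_weak_grad_0: "has_weak_grad S (\<lambda>x. 0) (\<lambda>x. 0)"
  by (simp add: has_weak_grad_def L2_0)

text \<open>The chosen weak gradient of zero vanishes only almost everywhere, separately on each
  element; finiteness of the mesh combines the null sets.\<close>

lemma C0_curve_H1_mesh_0:
  assumes "finite \<T>" "\<Omega> \<in> sets lebesgue"
  shows "C0_curve (H1_mesh \<Omega> \<T>) (H1_mesh_norm \<Omega> \<T>) I (\<lambda>t x. 0)"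
proof -
  have "AE x in lebesgue. x \<in> interior K \<longrightarrow> weak_grad (interior K) (\<lambda>x. 0) x = 0" for K
    using weak_grad_AE[OF open_interior has_weak_grad_0, of K] by (simp add: AE_restrict_space_iff)
  then have "AE x in lebesgue. \<forall>K\<in>\<T>. x \<in> interior K \<longrightarrow> weak_grad (interior K) (\<lambda>x. 0) x = 0"
    using assms(1) by (simp add: AE_ball_countable countable_finite)
  then have "AE x in lebesgue. mesh_grad \<T> (\<lambda>x. 0) x = 0"
    by eventually_elim (auto simp: mesh_grad_def indicator_def intro!: sum.neutral)
  then have "AE x in lebesgue_on \<Omega>. mesh_grad \<T> (\<lambda>x. 0) x = 0"
    using assms(2) by (simp add: AE_restrict_space_iff) (auto elim: eventually_mono)
  then have "L2_norm \<Omega> (mesh_grad \<T> (\<lambda>x. 0)) = L2_norm \<Omega> (\<lambda>x. 0 :: R3)"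
    using assms(2) by (intro L2_norm_cong_AE)
  then have "H1_mesh_norm \<Omega> \<T> (\<lambda>x. 0) = 0"
    by (simp add: H1_mesh_norm_def L2_norm_def)
  moreover have "(\<lambda>x. 0) \<in> H1_mesh \<Omega> \<T>"
    using has_weak_grad_0 by (auto simp: H1_mesh_def H1_def L2_0)
  ultimately show ?thesis by (simp add: C0_curve_def)
qed

lemma eq_d_0: "eq_d \<Omega> \<T> (\<lambda>x. 0)"
proof -
  have "bdry_div K (\<lambda>x. 0) w = 0" for K w
    unfolding bdry_div_def
    by (rule integral_eq_zero_AE, rule eventually_mono[OF weak_grad_AE[OF open_interior has_weak_grad_0]]) simp
  then show ?thesis by (simp add: eq_d_def)
qed

theorem proposition3p5:
  fixes \<Omega> :: "(real ^ 3) set" and \<T> :: "(real ^ 3) set set"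
    and I :: "real set" and t0 :: real
    and \<epsilon> \<mu> :: "real \<Rightarrow> real ^ 3 \<Rightarrow> real ^ 3 ^ 3"
    and J A Hh Dh :: "real \<Rightarrow> real ^ 3 \<Rightarrow> real ^ 3"
    and \<rho> :: "real \<Rightarrow> real ^ 3 \<Rightarrow> real"
    and Dh0 :: "real ^ 3 \<Rightarrow> real ^ 3"
  assumes "bounded_polyhedral_lipschitz_domain \<Omega>"
    and "tetrahedral_mesh \<Omega> \<T>"
    and "is_interval I" and "t0 \<in> I" and "\<exists>s\<in>I. s \<noteq> t0"
    and "material_tensor \<Omega> I \<epsilon>" and "material_tensor \<Omega> I \<mu>"
    and "sources \<Omega> I J \<rho>"
    and "temporal_gauge_solution \<Omega> \<T> I \<epsilon> \<mu> J A Hh"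
    and "Dh0 \<in> Hdiv \<Omega>"
    and "eq_b \<T> (D_field \<Omega> \<T> I \<epsilon> A (\<lambda>t x. 0) t0) (\<rho> t0) Dh0"
    and "Dh_evolution \<Omega> I J Hh Dh"
    and "AE x in lebesgue_on \<Omega>. Dh t0 x = Dh0 x"
  shows "maxwell_solution \<Omega> \<T> I \<epsilon> \<mu> J \<rho> A (\<lambda>t x. 0) Hh Dh"
proof -
  have lip: "lipschitz_domain \<Omega>" using assms(1) by (simp add: bounded_polyhedral_lipschitz_domain_def)
  then have \<Omega>: "open \<Omega>" "\<Omega> \<in> sets lebesgue" by (auto simp: lipschitz_domain_def)
  have mesh: "interior K \<subseteq> \<Omega>" if "K \<in> \<T>" for K
    using mesh_interior_subset[OF lip assms(2) that] .
  have "finite \<T>" using assms(2) by (simp add: tetrahedral_mesh_def triangulation_def)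
  let ?D = "D_field \<Omega> \<T> I \<epsilon> A (\<lambda>t x. 0)"
  have sol: "C1_curve (Hcurl_mesh \<Omega> \<T>) (Hcurl_mesh_norm \<Omega> \<T>) I A"
    "C1_curve (L2 \<Omega>) (L2_norm \<Omega>) I ?D" "C0_curve (Hcurl \<Omega>) (Hcurl_norm \<Omega>) I Hh"
    and a: "\<And>t. t \<in> I \<Longrightarrow> eq_a \<T> (dt \<Omega> I ?D t) (J t) (H_field \<T> \<mu> A t) (Hh t)"
    and c: "\<And>t. t \<in> I \<Longrightarrow> eq_c \<Omega> \<T> (A t)"
    using assms(9) unfolding temporal_gauge_solution_def by blast+
  have Hh: "Hh t \<in> Hcurl \<Omega>" if "t \<in> I" for t
    using sol(3) that by (simp add: C0_curve_def)
  \<comment> \<open>The curve starts at \<open>Dh0\<close> only up to a null set, so membership in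
    \<open>Hdiv \<Omega>\<close> and equation (b) have to be carried over to
    \<open>Dh t0\<close>.\<close>
  have init: "AE x in lebesgue_on \<Omega>. Dh0 x = Dh t0 x"
    using assms(13) by eventually_elim simp
  have Dh_L2: "Dh t0 \<in> L2 \<Omega>"
    using assms(4,12) by (auto simp: Dh_evolution_def C1_curve_def)
  have div0: "has_weak_div \<Omega> Dh0 (weak_div \<Omega> Dh0)"
    using assms(10) by (rule has_weak_div_weak_div)
  have Dh_init: "Dh t0 \<in> Hdiv \<Omega>"
    using has_weak_div_cong_AE[OF \<Omega>(2) init div0] Dh_L2 by (auto simp: Hdiv_def)
  have "bdry_div K f Dh0 = bdry_div K f (Dh t0)" if "K \<in> \<T>" for K f
  proof (rule bdry_div_cong_AE)
    show "AE x in lebesgue_on (interior K). Dh0 x = Dh t0 x"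
      using AE_lebesgue_on_subset[OF _ \<Omega>(2) mesh[OF that] init] by simp
    show "has_weak_div (interior K) Dh0 (weak_div \<Omega> Dh0)"
      using has_weak_div_subset[OF div0 open_interior \<Omega>(1) mesh[OF that]] .
  qed
  then have b0: "eq_b \<T> (?D t0) (\<rho> t0) (Dh t0)"
    using assms(11) by (simp add: eq_b_def)
  have b: "eq_b \<T> (?D t) (\<rho> t) (Dh t)" if "t \<in> I" for t
    using \<Omega>(1) mesh assms(3,4) that assms(8) Hh assms(12) sol(2) a Dh_init b0
    by (rule eq_b_propagates)
  have d: "C0_curve (Hdiv \<Omega>) (Hdiv_norm \<Omega>) I Dh"
    using \<Omega>(1) assms(3,4,8) Hh assms(12) Dh_init by (rule C0_curve_Hdiv_evolution)
  show ?thesis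
    unfolding maxwell_solution_def
    by (intro conjI ballI sol a b c d eq_d_0 C0_curve_H1_mesh_0[OF \<open>finite \<T>\<close> \<Omega>(2)])
qed

end
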